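(* Let $f, g : \mathbb{C} \to \mathbb{C}$ be entire functions such that $$\underline{\tau} := \liminf_{r \to \infty} \frac{\log \max_{|z| = r} |f(z)|}{r^2} < \infty$$ and $g$ is of exponential type $\kappa \in [0,\infty)$. Let $z_0, \omega_1, \omega_2 \in \mathbb{C}$ with $\omega_1, \omega_2 \neq 0$ and $\omega_1/\omega_2 \notin \mathbb{R}$, and let $\Lambda = z_0 + \omega_1\mathbb{Z} + \omega_2\mathbb{Z} \subset \mathbb{C}$ be the corresponding shifted lattice. Suppose that its covolume satisfies $\operatorname{covol}(\Lambda) < \pi/(2\underline{\tau})$ and assume $$2\kappa \cdot |\omega_2| < \pi, \qquad 2\kappa \cdot \frac{|\operatorname{Im}(\omega_1\overline{\omega_2})|}{|\omega_2|} < \pi.$$ Then, $f \sim g$ if and only if $|f| = |g|$ on $\Lambda$.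
   Context: Two functions satisfy $f \sim g$ if there exists $\sigma \in \mathbb{C}$ with $|\sigma| = 1$ and $f = \sigma g$. An entire function $g$ is of exponential type $\kappa$ if $\limsup_{r \to \infty} r^{-1} \log \max_{|z|=r} |g(z)| = \kappa$. The convention $\log 0 = -\infty$ is used. The covolume of the shifted lattice $\Lambda = z_0 + \omega_1\mathbb{Z} + \omega_2\mathbb{Z} = \{ z_0 + \omega_1 m + \omega_2 n : m,n \in \mathbb{Z} \}$ is $\operatorname{covol}(\Lambda) := |\operatorname{Im}(\omega_1\overline{\omega_2})|$. If $\underline{\tau} \leq 0$, then $\pi/(2\underline{\tau})$ is read as $+\infty$, i.e. the covolume condition is void (the condition is the reformulation of $1/\operatorname{covol}(\Lambda) > 2\underline{\tau}/\pi$). *)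

theory Defs
  imports "HOL-Complex_Analysis.Complex_Analysis"
begin

definition elog :: "real \<Rightarrow> ereal" where
  "elog x = (if x = 0 then -\<infinity> else ereal (ln x))"

text \<open>For continuous \<open>f\<close> and \<open>r \<ge> 0\<close> the supremum is attained, so it is the maximum.\<close>

definition max_modulus :: "(complex \<Rightarrow> complex) \<Rightarrow> real \<Rightarrow> real" where
  "max_modulus f r = (SUP z\<in>sphere 0 r. norm (f z))"

definition lower_quadratic_growth :: "(complex \<Rightarrow> complex) \<Rightarrow> ereal" where
  "lower_quadratic_growth f = Liminf at_top (\<lambda>r::real. elog (max_modulus f r) / ereal (r\<^sup>2))"

definition exponential_type :: "(complex \<Rightarrow> complex) \<Rightarrow> real \<Rightarrow> bool" where
  "exponential_type g \<kappa> \<longleftrightarrow> g holomorphic_on UNIV \<and>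
     Limsup at_top (\<lambda>r::real. elog (max_modulus g r) / ereal r) = ereal \<kappa>"

definition equal_up_to_phase :: "(complex \<Rightarrow> complex) \<Rightarrow> (complex \<Rightarrow> complex) \<Rightarrow> bool"
    (infix \<open>\<sim>\<^sub>p\<close> 50) where
  "f \<sim>\<^sub>p g \<longleftrightarrow> (\<exists>\<sigma>::complex. norm \<sigma> = 1 \<and> f = (\<lambda>z. \<sigma> * g z))"

definition shifted_lattice :: "complex \<Rightarrow> complex \<Rightarrow> complex \<Rightarrow> complex set" where
  "shifted_lattice z0 \<omega>1 \<omega>2 = {z0 + \<omega>1 * of_int m + \<omega>2 * of_int n | m n. True}"

text \<open>The covolume is a function of the generators; it depends only on the lattice they span.\<close>

definition covol :: "complex \<Rightarrow> complex \<Rightarrow> real" where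
  "covol \<omega>1 \<omega>2 = \<bar>Im (\<omega>1 * cnj \<omega>2)\<bar>"

end

theory Submission
  imports Defs
begin

text \<open>
  A Weierstrass-type sigma function \<open>\<sigma>\<close> of the lattice grows exactly like \<open>exp (pi |z|^2 / (2 covol))\<close>
  away from its zeros, faster than \<open>f\<close> along a sequence of radii. Hence Lagrange interpolation with \<open>\<sigma>\<close>
  bounds \<open>f\<close> near any lattice point by the values of \<open>f\<close> on the lattice, and those equal \<open>|g|\<close>. So
  \<open>f\<close> is dominated by \<open>C exp (k |z|)\<close> as well, for any \<open>k > \<kappa>\<close>.

  After scaling to \<open>\<omega>2 = 1\<close>, the entire function \<open>f(a + z) cnj (f(a + cnj z)) - g(a + z) cnj (g(a + cnj z))\<close>
  with \<open>a = m \<tau>\<close> has type at most \<open>2 k < pi\<close> and vanishes on the integers, hence identically by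
  Carlson's theorem. For fixed \<open>w\<close>, this says that the function
  \<open>f(w) cnj (f(cnj \<zeta>)) - g(w) cnj (g(cnj \<zeta>))\<close> of \<open>\<zeta>\<close> vanishes on an arithmetic progression of step
  \<open>2 i Im \<tau>\<close>, so a second application of Carlson's theorem gives
  \<open>f(w) cnj (f v) = g(w) cnj (g v)\<close> for all \<open>w\<close>, \<open>v\<close>.
\<close>

subsection \<open>Carlson's theorem\<close>

text \<open>At a common zero both difference quotients extend holomorphically, and that of
  \<open>\<sigma>\<close> does not vanish there because the zero is simple. The divisor is the sine
  in Carlson's theorem and the sigma function in the interpolation.\<close>

lemma holomorphic_quotient_simple_zeros:
  assumes h: "h holomorphic_on UNIV" and \<sigma>: "\<sigma> holomorphic_on UNIV" and S: "open S"
    and zero: "\<And>z. z \<in> S \<Longrightarrow> \<sigma> z = 0 \<Longrightarrow> h z = 0 \<and> deriv \<sigma> z \<noteq> 0"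
  obtains q where "q holomorphic_on S" "\<And>z. z \<in> S \<Longrightarrow> h z = q z * \<sigma> z"
proof -
  define q where "q = (\<lambda>z. if \<sigma> z = 0 then deriv h z / deriv \<sigma> z else h z / \<sigma> z)"
  have "q field_differentiable (at w)" if w: "w \<in> S" for w
  proof (cases "\<sigma> w = 0")
    case True
    \<comment> \<open>The difference quotient at \<open>w\<close> with its removable singularity
      filled. Near \<open>w\<close> the common factor \<open>z - w\<close> cancels, so
      \<open>q\<close> agrees with \<open>D h / D \<sigma>\<close>.\<close>
    define D where "D = (\<lambda>(f::complex \<Rightarrow> complex) z. if z = w then deriv f w else (f z - f w) / (z - w))"
    have D: "D f holomorphic_on UNIV" if "f holomorphic_on UNIV" for f
      unfolding D_def by (rule pole_lemma[OF that]) simp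
    define T where "T = {z. D \<sigma> z \<noteq> 0} \<inter> S"
    have "continuous_on UNIV (D \<sigma>)"
      by (intro holomorphic_on_imp_continuous_on D \<sigma>)
    then have "open T"
      unfolding T_def by (intro open_Int S open_Collect_neq continuous_intros) auto
    moreover have "w \<in> T"
      using zero[OF w True] w by (simp add: T_def D_def)
    moreover have "(\<lambda>z. D h z / D \<sigma> z) holomorphic_on T"
      by (intro holomorphic_intros holomorphic_on_subset[OF D[OF h]] holomorphic_on_subset[OF D[OF \<sigma>]])
        (auto simp: T_def)
    moreover have "D h z / D \<sigma> z = q z" if "z \<in> T" for z
    proof -
      have hw: "h w = 0" using zero[OF w True] by simp
      show ?thesis
      proof (cases "z = w")
        case True
        then show ?thesis using \<open>\<sigma> w = 0\<close> by (simp add: q_def D_def)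
      next
        case False
        then show ?thesis using that \<open>\<sigma> w = 0\<close> hw by (auto simp: q_def D_def T_def)
      qed
    qed
    ultimately have "q holomorphic_on T"
      by (metis (no_types, lifting) holomorphic_transform)
    then show ?thesis
      using \<open>open T\<close> \<open>w \<in> T\<close> holomorphic_on_imp_differentiable_at by blast
  next
    case False
    define T where "T = {z. \<sigma> z \<noteq> 0}"
    have "open T"
      unfolding T_def using holomorphic_on_imp_continuous_on[OF \<sigma>]
      by (intro open_Collect_neq continuous_intros) auto
    moreover have "(\<lambda>z. h z / \<sigma> z) holomorphic_on T"
      by (intro holomorphic_intros holomorphic_on_subset[OF h] holomorphic_on_subset[OF \<sigma>])
        (auto simp: T_def)
    then have "q holomorphic_on T"
      by (rule holomorphic_transform) (auto simp: q_def T_def)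
    ultimately show ?thesis
      using False holomorphic_on_imp_differentiable_at[of q T w] by (simp add: T_def)
  qed
  then have "q holomorphic_on S"
    by (simp add: holomorphic_on_def field_differentiable_at_within)
  moreover have "h z = q z * \<sigma> z" if "z \<in> S" for z
    using zero[OF that] by (auto simp: q_def)
  ultimately show ?thesis using that by blast
qed

lemma filterlim_powr_at_top:
  fixes p :: real
  assumes "p > 0"
  shows "filterlim (\<lambda>x. x powr p) at_top at_top"
proof -
  have "filterlim (\<lambda>x. exp (p * ln x)) at_top at_top"
    by (intro filterlim_compose[OF exp_at_top] filterlim_tendsto_pos_mult_at_top[OF tendsto_const assms] ln_at_top)
  moreover have "eventually (\<lambda>x. exp (p * ln x) = x powr p) at_top"
    using eventually_gt_at_top[of 0] by eventually_elim (simp add: powr_def)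
  ultimately show ?thesis
    by (rule filterlim_mono_eventually[OF _ order_refl order_refl])
qed

text \<open>
  On the remaining sector of opening less than \<open>pi\<close>, the factor \<open>exp (- \<epsilon> z powr \<rho>)\<close> with \<open>\<rho>\<close>
  slightly larger than 1 beats the exponential growth; then \<open>\<epsilon>\<close> tends to 0.
\<close>

lemma phragmen_lindelof_sector:
  fixes q :: "complex \<Rightarrow> complex"
  assumes q: "q holomorphic_on UNIV" and s: "0 < s" "s < 1" and B: "B > 0"
    and growth: "\<And>z. norm (q z) \<le> C * exp (k * norm z)"
    and outer: "\<And>z. s * norm z \<le> \<bar>Im z\<bar> \<Longrightarrow> norm (q z) \<le> B"
    and disc: "\<And>z. norm z \<le> 1 \<Longrightarrow> norm (q z) \<le> B"
    and "Re z0 \<ge> 0"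
  shows "norm (q z0) \<le> B"
proof (cases "s * norm z0 \<le> \<bar>Im z0\<bar> \<or> norm z0 \<le> 1")
  case True
  then show ?thesis using outer disc by blast
next
  case z0: False
  have Re_z0: "Re z0 > 0"
  proof (rule ccontr)
    assume "\<not> Re z0 > 0"
    then have "norm z0 = \<bar>Im z0\<bar>" using \<open>Re z0 \<ge> 0\<close> by (simp add: cmod_def)
    then have "s * norm z0 \<le> \<bar>Im z0\<bar>" using s mult_right_mono[of s 1 "norm z0"] by simp
    then show False using z0 by simp
  qed
  \<comment> \<open>For \<open>z\<close> of argument \<theta>,
    \<open>\<bar>Im z\<bar> = norm z * \<bar>sin \<theta>\<bar>\<close>, so what remains of the
    right half-plane is the sector of half-opening \<alpha>.\<close>
  define \<alpha> where "\<alpha> = arcsin s"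
  have \<alpha>: "0 < \<alpha>" "\<alpha> < pi / 2" "sin \<alpha> = s"
    using s arcsin_less_arcsin[of 0 s] arcsin_less_arcsin[of s 1] by (auto simp: \<alpha>_def)
  \<comment> \<open>The midpoint of \<open>1\<close> and \<open>pi / (2 * \<alpha>)\<close>: above
    the lower end, so that the damping beats exponential growth, and below the upper one, so that
    \<open>cos (\<rho> * \<theta>)\<close> stays at least \<open>c > 0\<close> on the
    sector.\<close>
  define \<rho> where "\<rho> = (1 + pi / (2 * \<alpha>)) / 2"
  have "1 < pi / (2 * \<alpha>)" using \<alpha> by (simp add: field_simps)
  then have \<rho>: "1 < \<rho>" "\<rho> < pi / (2 * \<alpha>)" by (auto simp: \<rho>_def)
  have \<rho>\<alpha>: "0 < \<rho> * \<alpha>" "\<rho> * \<alpha> < pi / 2" using \<rho> \<alpha> by (auto simp: field_simps)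
  define c where "c = cos (\<rho> * \<alpha>)"
  have c: "c > 0" unfolding c_def using \<rho>\<alpha> by (intro cos_gt_zero) auto
  have Re_powr: "Re (z powr of_real \<rho>) \<ge> c * norm z powr \<rho>"
    if "Re z > 0" "\<bar>Im z\<bar> \<le> s * norm z" for z
  proof -
    have nz: "z \<noteq> 0" using that by auto
    define \<theta> where "\<theta> = Im (Ln z)"
    have \<theta>: "\<bar>\<theta>\<bar> < pi / 2" unfolding \<theta>_def using that by (rule_tac Re_Ln_pos_lt_imp)
    have Ln: "Ln z = Complex (ln (norm z)) \<theta>" using nz by (simp add: complex_eq_iff \<theta>_def)
    have "z = exp (Ln z)" using nz by simp
    then have "Im z = norm z * sin \<theta>" unfolding Ln using nz by (metis Im_exp complex.sel exp_ln zero_less_norm_iff)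
    then have "\<bar>sin \<theta>\<bar> \<le> s" using that nz by (simp add: abs_mult mult.commute)
    then have "sin \<bar>\<theta>\<bar> \<le> sin \<alpha>" using \<alpha> by (cases "\<theta> \<ge> 0") auto
    then have "\<bar>\<theta>\<bar> \<le> \<alpha>"
      using \<theta> \<alpha> sin_mono_le_eq[of "\<bar>\<theta>\<bar>" \<alpha>] by auto
    then have "cos (\<rho> * \<alpha>) \<le> cos (\<rho> * \<bar>\<theta>\<bar>)"
      using \<rho> \<rho>\<alpha> by (intro cos_monotone_0_pi_le) auto
    also have "cos (\<rho> * \<bar>\<theta>\<bar>) = cos (\<rho> * \<theta>)"
      by (cases "\<theta> \<ge> 0") auto
    finally have "c * norm z powr \<rho> \<le> norm z powr \<rho> * cos (\<rho> * \<theta>)"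
      unfolding c_def by (subst mult.commute) (auto intro: mult_left_mono)
    also have "\<dots> = Re (z powr of_real \<rho>)"
      using nz by (simp add: powr_def Ln Re_exp)
    finally show ?thesis .
  qed
  have eps: "norm (q z0) \<le> B * exp (\<epsilon> * Re (z0 powr of_real \<rho>))" if \<epsilon>: "\<epsilon> > 0" for \<epsilon> :: real
  proof -
    \<comment> \<open>The product is \<open>\<epsilon> * c * R powr \<rho> - k * R\<close>; its
      divergence makes the damped function at most \<open>B\<close> on a far arc.\<close>
    have "filterlim (\<lambda>R::real. R * (\<epsilon> * c * R powr (\<rho> - 1) - k)) at_top at_top"
    proof (rule filterlim_at_top_mult_at_top[OF filterlim_ident])
      have "filterlim (\<lambda>R::real. \<epsilon> * c * R powr (\<rho> - 1)) at_top at_top"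
        using \<epsilon> c \<rho> by (intro filterlim_tendsto_pos_mult_at_top[OF tendsto_const] filterlim_powr_at_top) auto
      then have "filterlim (\<lambda>R::real. - k + \<epsilon> * c * R powr (\<rho> - 1)) at_top at_top"
        by (intro filterlim_tendsto_add_at_top[OF tendsto_const])
      then show "filterlim (\<lambda>R::real. \<epsilon> * c * R powr (\<rho> - 1) - k) at_top at_top" by simp
    qed
    then have "eventually (\<lambda>R. R * (\<epsilon> * c * R powr (\<rho> - 1) - k) \<ge> ln (max C 1 / B)) at_top"
      by (simp add: filterlim_at_top)
    then have "eventually (\<lambda>R. R * (\<epsilon> * c * R powr (\<rho> - 1) - k) \<ge> ln (max C 1 / B) \<and> R > norm z0) at_top"
      using eventually_gt_at_top[of "norm z0"] by (rule eventually_conj)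
    then obtain R where R: "R * (\<epsilon> * c * R powr (\<rho> - 1) - k) \<ge> ln (max C 1 / B)" "R > norm z0"
      by (auto dest: eventually_happens)
    have R1: "R > 1" using R z0 by linarith
    then have "R powr \<rho> = R * R powr (\<rho> - 1)"
      by (simp add: powr_diff)
    then have "ln (max C 1 / B) \<le> \<epsilon> * (c * R powr \<rho>) - k * R"
      using R(1) by (simp add: algebra_simps)
    then have "max C 1 / B \<le> exp (\<epsilon> * (c * R powr \<rho>) - k * R)"
      using B by (metis exp_le_cancel_iff exp_ln divide_pos_pos less_max_iff_disj zero_less_one)
    then have far: "max C 1 * exp (k * R) * exp (- \<epsilon> * (c * R powr \<rho>)) \<le> B"
      using B by (simp add: field_simps exp_diff exp_minus)
    \<comment> \<open>A truncated sector. Cutting out the unit disc keeps the closure away from the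
      branch point of \<open>z powr \<rho>\<close> at 0; the rest of the closure lies in
      \<open>Re z > 0\<close>, off the branch cut.\<close>
    define S where "S = {z. Re z > 0} \<inter> {z. \<bar>Im z\<bar> < s * norm z} \<inter> {z. 1 < norm z} \<inter> {z. norm z < R}"
    define K where "K = {z. Re z \<ge> 0} \<inter> {z. \<bar>Im z\<bar> \<le> s * norm z} \<inter> {z. 1 \<le> norm z} \<inter> {z. norm z \<le> R}"
    have "open S" unfolding S_def by (intro open_Int open_Collect_less continuous_intros)
    have "closed K" unfolding K_def by (intro closed_Int closed_Collect_le continuous_intros)
    then have SK: "closure S \<subseteq> K" by (intro closure_minimal) (auto simp: S_def K_def)
    have K_pos: "Re z > 0" if "z \<in> K" for z
    proof (rule ccontr)
      assume "\<not> Re z > 0"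
      then have "norm z = \<bar>Im z\<bar>" "norm z > 0" using that by (auto simp: cmod_def K_def)
      then show False using that s mult_strict_right_mono[of s 1 "norm z"] by (simp add: K_def)
    qed
    define F where "F = (\<lambda>z. q z * exp (- (of_real \<epsilon> * z powr of_real \<rho>)))"
    have "F holomorphic_on K"
      unfolding F_def
      by (intro holomorphic_intros holomorphic_on_subset[OF q]) (auto simp: complex_nonpos_Reals_iff dest: K_pos)
    have nF: "norm (F z) \<le> norm (q z) * exp (- \<epsilon> * (c * norm z powr \<rho>))" if "z \<in> K" for z
    proof -
      have "\<epsilon> * (c * norm z powr \<rho>) \<le> \<epsilon> * Re (z powr of_real \<rho>)"
        using Re_powr[OF K_pos[OF that]] that \<epsilon> by (intro mult_left_mono) (auto simp: K_def)
      then show ?thesis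
        by (auto simp: F_def norm_mult intro!: mult_left_mono)
    qed
    have "norm (F z0) \<le> B"
    proof (rule maximum_modulus_frontier[where f = F and S = S and \<xi> = z0])
      show "F holomorphic_on interior S"
        by (rule holomorphic_on_subset[OF \<open>F holomorphic_on K\<close>]) (use SK closure_subset interior_subset in blast)
      show "continuous_on (closure S) F"
        by (rule continuous_on_subset[OF holomorphic_on_imp_continuous_on[OF \<open>F holomorphic_on K\<close>] SK])
      show "bounded S"
        by (rule bounded_subset[of "ball 0 R"]) (auto simp: S_def)
      show "z0 \<in> S" using z0 Re_z0 R by (auto simp: S_def)
      fix z assume z: "z \<in> frontier S"
      then have zK: "z \<in> K" and "z \<notin> S"
        using SK \<open>open S\<close> by (auto simp: frontier_def interior_open)
      then consider "\<bar>Im z\<bar> = s * norm z" | "norm z = 1" | "norm z = R"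
        using K_pos[OF zK] by (auto simp: S_def K_def)
      then show "norm (F z) \<le> B"
      proof cases
        case 3
        have "norm (F z) \<le> C * exp (k * R) * exp (- \<epsilon> * (c * R powr \<rho>))"
          using nF[OF zK] growth[of z] 3 by (auto elim!: order_trans intro!: mult_right_mono)
        also have "\<dots> \<le> max C 1 * exp (k * R) * exp (- \<epsilon> * (c * R powr \<rho>))"
          by (intro mult_right_mono) auto
        finally show ?thesis using far by linarith
      next
        case 1
        then have "norm (q z) \<le> B" using outer by simp
        moreover have "exp (- \<epsilon> * (c * norm z powr \<rho>)) \<le> 1" using \<epsilon> c by simp
        ultimately have "norm (q z) * exp (- \<epsilon> * (c * norm z powr \<rho>)) \<le> B * 1"
          using B by (intro mult_mono) auto
        then show ?thesis using nF[OF zK] by simp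
      next
        case 2
        then have "norm (q z) \<le> B" using disc by simp
        moreover have "exp (- \<epsilon> * (c * norm z powr \<rho>)) \<le> 1" using \<epsilon> c by simp
        ultimately have "norm (q z) * exp (- \<epsilon> * (c * norm z powr \<rho>)) \<le> B * 1"
          using B by (intro mult_mono) auto
        then show ?thesis using nF[OF zK] by simp
      qed
    qed
    then have "norm (q z0) * exp (- (\<epsilon> * Re (z0 powr of_real \<rho>))) \<le> B"
      by (simp add: F_def norm_mult)
    then show ?thesis
      by (simp add: exp_minus field_simps)
  qed
  have "((\<lambda>\<epsilon>. B * exp (\<epsilon> * Re (z0 powr of_real \<rho>))) \<longlongrightarrow> B * exp (0 * Re (z0 powr of_real \<rho>))) (at_right 0)"
    by (intro tendsto_intros)
  moreover have "eventually (\<lambda>\<epsilon>. norm (q z0) \<le> B * exp (\<epsilon> * Re (z0 powr of_real \<rho>))) (at_right 0)"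
    using eps by (auto simp: eventually_at_right_less eventually_at_filter)
  ultimately have "norm (q z0) \<le> B * exp (0 * Re (z0 powr of_real \<rho>))"
    by (intro tendsto_lowerbound) auto
  then show ?thesis by simp
qed

text \<open>By \<open>norm_sin_squared\<close>, the squared modulus is at least
  \<open>(E\<^sup>2 - 2) / 4\<close> with \<open>E = exp (pi * \<bar>Im z\<bar>)\<close>, and at
  this distance from the real axis \<open>E\<close> is large enough to absorb the constant.\<close>

lemma norm_sin_pi_lower:
  assumes "1 \<le> \<bar>Im z\<bar>"
  shows "exp (pi * \<bar>Im z\<bar>) / 4 \<le> norm (sin (of_real pi * z))"
proof (rule power2_le_imp_le)
  define E where "E = exp (pi * \<bar>Im z\<bar>)"
  have "2 * 2 \<le> E"
  proof -
    have "2 * 2 \<le> 1 + pi * \<bar>Im z\<bar>"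
      using mult_mono[of 3 pi 1 "\<bar>Im z\<bar>"] pi_gt3 assms by auto
    also have "\<dots> \<le> E" unfolding E_def by (rule exp_ge_add_one_self)
    finally show ?thesis .
  qed
  then have E: "16 \<le> E\<^sup>2" using power_mono[of "2 * 2" E 2] by simp
  have exps: "exp (2 * (pi * Im z)) + inverse (exp (2 * (pi * Im z))) = E\<^sup>2 + inverse (E\<^sup>2)"
    unfolding E_def by (cases "Im z \<ge> 0") (simp_all add: exp_double exp_minus power_inverse)
  have "(E / 4)\<^sup>2 \<le> (E\<^sup>2 - 2) / 4"
    using E by (simp add: power_divide)
  also have "\<dots> \<le> (E\<^sup>2 + inverse (E\<^sup>2) - 2 * cos (2 * (pi * Re z))) / 4"
    using cos_le_one[of "2 * (pi * Re z)"] E by (smt (verit) divide_right_mono inverse_nonnegative_iff_nonnegative)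
  also have "\<dots> = (norm (sin (of_real pi * z)))\<^sup>2"
    unfolding norm_sin_squared using exps by simp
  finally show "(exp (pi * \<bar>Im z\<bar>) / 4)\<^sup>2 \<le> (norm (sin (of_real pi * z)))\<^sup>2"
    by (simp add: E_def)
qed simp

text \<open>On vertical lines halfway between the zeros the cosine in
  \<open>norm_sin_squared\<close> is -1, and \<open>a + inverse a\<close> is at least 2. The set
  described contains the edges of boxes around the integers, on which the quotient by the sine has
  to be bounded.\<close>

lemma norm_sin_pi_ge_1:
  assumes "1 \<le> \<bar>Im z\<bar> \<or> (\<exists>n::int. Re z = of_int n + 1 / 2)"
  shows "1 \<le> norm (sin (of_real pi * z))"
proof (cases "1 \<le> \<bar>Im z\<bar>")
  case True
  have "4 \<le> 1 + pi * \<bar>Im z\<bar>"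
    using mult_mono[of 3 pi 1 "\<bar>Im z\<bar>"] pi_gt3 True by auto
  also have "\<dots> \<le> exp (pi * \<bar>Im z\<bar>)" by (rule exp_ge_add_one_self)
  finally show ?thesis using norm_sin_pi_lower[OF True] by linarith
next
  case False
  then obtain n :: int where n: "Re z = of_int n + 1 / 2" using assms by blast
  have "2 * (pi * Re z) = pi + 2 * pi * of_int n"
    unfolding n by (simp add: field_simps)
  then have c: "cos (2 * (pi * Re z)) = - 1"
    by (simp add: cos_add)
  define a where "a = exp (2 * (pi * Im z))"
  have "a > 0" by (simp add: a_def)
  then have "2 \<le> a + inverse a"
    using sum_squares_ge_zero[of "a - 1" 0] by (simp add: field_simps power2_eq_square)
  then have "1 \<le> (norm (sin (of_real pi * z)))\<^sup>2"
    unfolding norm_sin_squared using c by (simp add: a_def)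
  then show ?thesis using power2_le_imp_le[of 1 "norm (sin (of_real pi * z))"] by simp
qed

text \<open>The quotient \<open>q\<close> of \<open>h\<close> by \<open>sin (pi z)\<close> is
  entire. It has exponential growth by the maximum principle on boxes around the zeros, and it is
  bounded outside two sectors about the real axis. Hence it is bounded by Phragmen-Lindeloef,
  constant by Liouville, and zero by its decay along the imaginary axis.\<close>

lemma carlson_integers:
  fixes h :: "complex \<Rightarrow> complex"
  assumes h: "h holomorphic_on UNIV" and growth: "\<And>z. norm (h z) \<le> C * exp (k * norm z)"
    and "k < pi" and zero: "\<And>n::int. h (of_int n) = 0"
  shows "h z = 0"
proof -
  have C: "C \<ge> 0" using growth[of 0] order_trans[OF norm_ge_zero] by auto
  \<comment> \<open>Raising the type to at least 1, which is still below \<open>pi\<close>, makes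
    the slope \<open>s = K / pi\<close> positive.\<close>
  define K where "K = max k 1"
  have K: "0 < K" "K < pi" "1 \<le> K" using \<open>k < pi\<close> pi_gt3 by (auto simp: K_def)
  have hK: "norm (h z) \<le> C * exp (K * norm z)" for z
    using growth[of z] C by (elim order_trans) (auto intro!: mult_left_mono mult_right_mono simp: K_def)
  define S where "S = (\<lambda>z::complex. sin (of_real pi * z))"
  have hol_S: "S holomorphic_on UNIV" unfolding S_def by (intro holomorphic_intros)
  have der: "(S has_field_derivative of_real pi * cos (of_real pi * z)) (at z)" for z
    unfolding S_def by (auto intro!: derivative_eq_intros)
  have S0: "h z = 0 \<and> deriv S z \<noteq> 0" if "S z = 0" for z
  proof
    obtain n :: int where "of_real pi * z = of_real (of_int n * pi)"
      using \<open>S z = 0\<close> unfolding S_def sin_eq_0 by blast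
    then have "z = of_int n" by simp
    then show "h z = 0" using zero by simp
    have "cos (of_real pi * z) \<noteq> 0"
      using sin_cos_squared_add[of "of_real pi * z"] that
      by (auto simp: S_def simp del: sin_cos_squared_add)
    then show "deriv S z \<noteq> 0" using DERIV_imp_deriv[OF der] by simp
  qed
  obtain q where q: "q holomorphic_on UNIV" "\<And>z. h z = q z * S z"
    using holomorphic_quotient_simple_zeros[OF h hol_S open_UNIV] S0 by (metis UNIV_I)
  have far: "norm (q z) \<le> 4 * C * exp (K * norm z - pi * \<bar>Im z\<bar>)" if "1 \<le> \<bar>Im z\<bar>" for z
  proof -
    have "norm (q z) * (exp (pi * \<bar>Im z\<bar>) / 4) \<le> norm (q z) * norm (S z)"
      unfolding S_def by (intro mult_left_mono norm_sin_pi_lower that) auto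
    also have "\<dots> \<le> C * exp (K * norm z)"
      using hK[of z] q(2) by (simp add: norm_mult)
    finally show ?thesis by (simp add: exp_diff field_simps)
  qed
  have edge: "norm (q z) \<le> C * exp (K * norm z)"
    if "1 \<le> \<bar>Im z\<bar> \<or> (\<exists>n::int. Re z = of_int n + 1 / 2)" for z
  proof -
    have "norm (q z) * 1 \<le> norm (q z) * norm (S z)"
      unfolding S_def by (intro mult_left_mono norm_sin_pi_ge_1 that) auto
    also have "\<dots> \<le> C * exp (K * norm z)"
      using hK[of z] q(2) by (simp add: norm_mult)
    finally show ?thesis by simp
  qed
  \<comment> \<open>The \<open>3\<close> bounds the distance between two points of the box
    \<open>Q\<close> below, whose sides are 1 and 2.\<close>
  define D where "D = C * exp (K * 3)"
  have D: "C \<le> D" "0 \<le> D" using C K mult_left_mono[of 1 "exp (K * 3)" C] by (auto simp: D_def)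
  have all: "norm (q z) \<le> D * exp (K * norm z)" for z
  proof (cases "1 \<le> \<bar>Im z\<bar>")
    case True
    then have "norm (q z) \<le> C * exp (K * norm z)" using edge by blast
    also have "\<dots> \<le> D * exp (K * norm z)" using D by (intro mult_right_mono) auto
    finally show ?thesis .
  next
    case False
    \<comment> \<open>The integer nearest to \<open>Re z\<close>. On all four edges of the box
      around it the sine has modulus at least 1, by \<open>norm_sin_pi_ge_1\<close>.\<close>
    define n where "n = \<lfloor>Re z + 1 / 2\<rfloor>"
    have n: "of_int n \<le> Re z + 1 / 2" "Re z + 1 / 2 < of_int n + 1"
      unfolding n_def by linarith+
    define Q where "Q = cbox (Complex (of_int n - 1 / 2) (-1)) (Complex (of_int n + 1 / 2) 1)"
    have Q: "w \<in> Q \<longleftrightarrow> of_int n - 1 / 2 \<le> Re w \<and> Re w \<le> of_int n + 1 / 2 \<and> \<bar>Im w\<bar> \<le> 1" for w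
      by (auto simp: Q_def in_cbox_complex_iff)
    show ?thesis
    proof (rule maximum_modulus_frontier[where f = q and S = Q and \<xi> = z])
      show "q holomorphic_on interior Q" "continuous_on (closure Q) q"
        using q(1) holomorphic_on_subset holomorphic_on_imp_continuous_on continuous_on_subset by blast+
      show "bounded Q" by (simp add: Q_def)
      show "z \<in> Q" using n False by (simp add: Q)
      fix w assume "w \<in> frontier Q"
      then have w: "w \<in> Q" "w \<notin> box (Complex (of_int n - 1 / 2) (-1)) (Complex (of_int n + 1 / 2) 1)"
        by (auto simp: Q_def frontier_cbox)
      then have "Re w = of_int (n - 1) + 1 / 2 \<or> Re w = of_int n + 1 / 2 \<or> \<bar>Im w\<bar> = 1"
        by (auto simp: Q in_box_complex_iff)
      then have "norm (q w) \<le> C * exp (K * norm w)"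
        using edge by (metis order_refl)
      also have "\<dots> \<le> C * exp (K * (3 + norm z))"
      proof -
        have "norm (w - z) \<le> \<bar>Re (w - z)\<bar> + \<bar>Im (w - z)\<bar>" by (rule cmod_le)
        also have "\<dots> \<le> 1 + 2" using w(1) \<open>z \<in> Q\<close> unfolding Q by (intro add_mono) auto
        finally have "norm w \<le> 3 + norm z" using norm_triangle_ineq2[of w z] by linarith
        then show ?thesis using C K by (intro mult_left_mono) auto
      qed
      also have "\<dots> = D * exp (K * norm z)" by (simp add: D_def distrib_left exp_add)
      finally show "norm (q w) \<le> D * exp (K * norm z)" .
    qed
  qed
  \<comment> \<open>With this slope, the growth \<open>K * norm z\<close> is at most the gain
    \<open>pi * \<bar>Im z\<bar>\<close> from the sine wherever
    \<open>s * norm z \<le> \<bar>Im z\<bar>\<close>.\<close>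
  define s where "s = K / pi"
  have s: "0 < s" "s < 1" using K by (auto simp: s_def)
  \<comment> \<open>The summand 1 keeps \<open>B\<close> positive when \<open>C = 0\<close>.\<close>
  define B where "B = 4 * D * exp pi + 1"
  have B: "B > 0" using D by (simp add: B_def add_nonneg_pos)
  have outer: "norm (q z) \<le> B" if z: "s * norm z \<le> \<bar>Im z\<bar>" for z
  proof (cases "1 \<le> \<bar>Im z\<bar>")
    case True
    have "K * norm z - pi * \<bar>Im z\<bar> \<le> 0"
      using z by (simp add: s_def field_simps)
    then have "K * norm z - pi * \<bar>Im z\<bar> \<le> pi"
      using pi_gt_zero by linarith
    then have "4 * C * exp (K * norm z - pi * \<bar>Im z\<bar>) \<le> 4 * D * exp pi"
      using C D by (intro mult_mono) auto
    then show ?thesis using far[OF True] by (simp add: B_def)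
  next
    case False
    then have "pi * \<bar>Im z\<bar> \<le> pi" by simp
    moreover have "K * norm z \<le> pi * \<bar>Im z\<bar>" using z by (simp add: s_def field_simps)
    ultimately have "K * norm z \<le> pi" by linarith
    then have "D * exp (K * norm z) \<le> 4 * D * exp pi"
      using D by (intro mult_mono) auto
    then show ?thesis using all[of z] by (simp add: B_def)
  qed
  have disc: "norm (q z) \<le> B" if "norm z \<le> 1" for z
  proof -
    have "K * norm z \<le> pi * 1" using K that by (intro mult_mono) auto
    then have "D * exp (K * norm z) \<le> 4 * D * exp pi"
      using D by (intro mult_mono) auto
    then show ?thesis using all[of z] by (simp add: B_def)
  qed
  have "norm (q z) \<le> B" for z
  proof (cases "Re z \<ge> 0")
    case True
    show ?thesis by (rule phragmen_lindelof_sector[OF q(1) s B all outer disc True])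
  next
    case False
    have "(\<lambda>z. q (- z)) holomorphic_on UNIV"
      using holomorphic_on_compose_gen[OF _ q(1), of uminus UNIV] by (simp add: o_def holomorphic_intros)
    moreover have "norm (q (- z)) \<le> D * exp (K * norm z)" for z using all[of "- z"] by simp
    moreover have "s * norm z \<le> \<bar>Im z\<bar> \<Longrightarrow> norm (q (- z)) \<le> B" for z using outer[of "- z"] by simp
    moreover have "norm z \<le> 1 \<Longrightarrow> norm (q (- z)) \<le> B" for z using disc[of "- z"] by simp
    ultimately have "norm (q (- (- z))) \<le> B"
      using False by (intro phragmen_lindelof_sector[of "\<lambda>z. q (- z)" s B D K "- z"] s B) auto
    then show ?thesis by simp
  qed
  then have "bounded (range q)" by (auto simp: bounded_iff)
  then obtain c where c: "\<And>z. q z = c"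
    using Liouville_theorem[OF q(1)] by (auto simp: constant_on_def)
  \<comment> \<open>The constant is read off on the imaginary axis, where \<open>K < pi\<close>
    forces decay.\<close>
  have "norm c \<le> 0"
  proof (rule tendsto_lowerbound)
    show "((\<lambda>y. 4 * C * exp ((K - pi) * y)) \<longlongrightarrow> 0) at_top"
    proof -
      have "filterlim (\<lambda>y. (K - pi) * y) at_bot at_top"
        using K by (intro filterlim_tendsto_neg_mult_at_bot[OF tendsto_const] filterlim_ident) auto
      then have "((\<lambda>y. exp ((K - pi) * y)) \<longlongrightarrow> 0) at_top"
        by (rule filterlim_compose[OF exp_at_bot])
      then show ?thesis by (intro tendsto_mult_right_zero)
    qed
    show "eventually (\<lambda>y. norm c \<le> 4 * C * exp ((K - pi) * y)) at_top"
      using eventually_ge_at_top[of 1]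
    proof eventually_elim
      case (elim y)
      then show ?case using far[of "\<i> * of_real y"] c by (simp add: norm_mult algebra_simps)
    qed
  qed simp
  then show ?thesis using q(2) c by simp
qed

text \<open>Substituting \<open>a + b * z\<close> moves the zeros to the integers and multiplies the
  type by \<open>norm b\<close>.\<close>

lemma carlson:
  fixes h :: "complex \<Rightarrow> complex"
  assumes h: "h holomorphic_on UNIV" and growth: "\<And>z. norm (h z) \<le> C * exp (k * norm z)"
    and "0 \<le> k" "b \<noteq> 0" and "k * norm b < pi" and zero: "\<And>n::int. h (a + b * of_int n) = 0"
  shows "h z = 0"
proof -
  have C: "C \<ge> 0" using growth[of 0] order_trans[OF norm_ge_zero] by auto
  have "(\<lambda>z. h (a + b * z)) holomorphic_on UNIV"
    using holomorphic_on_compose_gen[OF _ h, of "\<lambda>z. a + b * z" UNIV]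
    by (simp add: o_def holomorphic_intros)
  moreover have "norm (h (a + b * z)) \<le> C * exp (k * norm a) * exp (k * norm b * norm z)" for z
  proof -
    have "norm (h (a + b * z)) \<le> C * exp (k * norm (a + b * z))" by (rule growth)
    also have "\<dots> \<le> C * exp (k * (norm a + norm b * norm z))"
      using C \<open>0 \<le> k\<close> norm_triangle_ineq[of a "b * z"]
      by (intro mult_left_mono) (auto simp: norm_mult intro!: mult_left_mono)
    finally show ?thesis by (simp add: distrib_left exp_add mult_ac)
  qed
  ultimately have "h (a + b * ((z - a) / b)) = 0"
    by (rule carlson_integers) (use assms in auto)
  then show ?thesis using \<open>b \<noteq> 0\<close> by simp
qed

subsection \<open>The sigma function of a lattice\<close>

text \<open>\<open>R\<close> is the infinite product of the factors
  \<open>1 - q ^ Suc n * z\<close>, a q-Pochhammer symbol, entire as a Weierstrass product of genus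
  0. Peeling off its first factor leaves the same product at \<open>q * z\<close>, which is the
  functional equation.\<close>

lemma q_product_exists:
  fixes q :: complex
  assumes "q \<noteq> 0" "norm q < 1"
  obtains R where "R holomorphic_on UNIV" "\<And>z. R z = 0 \<longleftrightarrow> (\<exists>n. q ^ Suc n * z = 1)"
    "\<And>z. R z = (1 - q * z) * R (q * z)"
proof -
  define a where "a = (\<lambda>n. inverse q ^ Suc n)"
  have fac: "weierstrass_factor 0 (z / a n) = 1 - q ^ Suc n * z" for n z
    using assms by (simp add: weierstrass_factor_def a_def field_simps)
  have lim: "filterlim a at_infinity at_top"
  proof -
    have "1 < norm (inverse q)"
      using assms by (simp add: norm_inverse one_less_inverse)
    then have "filterlim (\<lambda>n. inverse q ^ n) at_infinity at_top"
      by (rule filterlim_realpow_sequentially_gt1)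
    then show ?thesis
      unfolding a_def by (rule filterlim_compose) (rule filterlim_Suc)
  qed
  \<comment> \<open>The exponent \<open>Suc 0\<close> is the convergence condition for genus 0; the
    terms form a geometric series.\<close>
  have summ: "summable (\<lambda>n. (r / norm (a n)) ^ Suc 0)" for r :: real
  proof -
    have "summable (\<lambda>n. r * norm q * norm q ^ n)"
      using assms by (intro summable_mult summable_geometric) auto
    moreover have "r * norm q * norm q ^ n = (r / norm (a n)) ^ Suc 0" for n
      by (simp add: a_def norm_power norm_inverse norm_mult divide_inverse power_inverse)
    ultimately show ?thesis by simp
  qed
  interpret W: weierstrass_product a "\<lambda>_. 0"
    using assms lim summ by unfold_locales (auto simp: a_def)
  have tend: "(\<lambda>N. \<Prod>n<N. 1 - q ^ Suc n * z) \<longlonglongrightarrow> W.f z" for z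
    using has_prod_imp_tendsto'[OF W.has_prod[of z]] by (simp only: fac)
  show ?thesis
  proof (rule that[of W.f])
    show "W.f holomorphic_on UNIV" by (rule W.holomorphic)
    show "W.f z = 0 \<longleftrightarrow> (\<exists>n. q ^ Suc n * z = 1)" for z
    proof -
      have "z = a n \<longleftrightarrow> q ^ Suc n * z = 1" for n
        using assms by (auto simp: a_def power_inverse field_simps)
      then show ?thesis unfolding W.zero image_iff by simp
    qed
    show "W.f z = (1 - q * z) * W.f (q * z)" for z
    proof -
      have "(\<Prod>n<Suc N. 1 - q ^ Suc n * z) = (1 - q * z) * (\<Prod>n<N. 1 - q ^ Suc n * (q * z))" for N
        by (subst prod.lessThan_Suc_shift) (simp add: mult_ac)
      moreover have "(\<lambda>N. \<Prod>n<Suc N. 1 - q ^ Suc n * z) \<longlonglongrightarrow> W.f z"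
        using tend[of z] by (rule LIMSEQ_Suc)
      moreover have "(\<lambda>N. (1 - q * z) * (\<Prod>n<N. 1 - q ^ Suc n * (q * z))) \<longlonglongrightarrow> (1 - q * z) * W.f (q * z)"
        by (intro tendsto_intros tend)
      ultimately show ?thesis
        by (simp only:) (metis LIMSEQ_unique)
    qed
  qed
qed

lemma periodic_int_multiple:
  fixes h :: "complex \<Rightarrow> 'a"
  assumes "\<And>z. h (z + w) = h z"
  shows "h (z + w * of_int m) = h z"
proof -
  have nat: "h (z + w * of_nat n) = h z" for z n
  proof (induction n)
    case (Suc n)
    then show ?case using assms[of "z + w * of_nat n"] by (simp add: algebra_simps)
  qed simp
  show ?thesis
  proof (cases m rule: int_cases2)
    case (nonneg n)
    then show ?thesis using nat by simp
  next
    case (nonpos n)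
    then show ?thesis using nat[of "z - w * of_nat n" n] by simp
  qed
qed

text \<open>
  With \<open>u = exp (2 pi i z)\<close> and \<open>q = exp (2 pi i \<tau>)\<close>, the product \<open>(1 - u) R(u) R(1/u)\<close> has the lattice
  as its zero set; the factor \<open>E\<close> makes its quasi-periodicity isotropic.
\<close>

lemma sigma_function_exists:
  fixes \<tau> :: complex
  assumes t: "Im \<tau> > 0"
  obtains \<sigma> where "\<sigma> holomorphic_on UNIV"
    "\<And>z w. w \<in> shifted_lattice 0 \<tau> 1 \<Longrightarrow>
      norm (\<sigma> (z + w)) * exp (- (pi / (2 * Im \<tau>)) * (norm (z + w))\<^sup>2) =
      norm (\<sigma> z) * exp (- (pi / (2 * Im \<tau>)) * (norm z)\<^sup>2)"
    "\<And>z. \<sigma> z = 0 \<longleftrightarrow> z \<in> shifted_lattice 0 \<tau> 1"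
    "deriv \<sigma> 0 \<noteq> 0"
proof -
  define t where "t = Im \<tau>"
  define e where "e = (\<lambda>z. exp (2 * of_real pi * \<i> * z))"
  define q where "q = e \<tau>"
  have t0: "t > 0" using assms by (simp add: t_def)
  have q: "q \<noteq> 0" "norm q < 1"
    using t0 by (auto simp: q_def e_def norm_exp_eq_Re t_def)
  obtain R where R: "R holomorphic_on UNIV" "\<And>z. R z = 0 \<longleftrightarrow> (\<exists>n. q ^ Suc n * z = 1)"
    "\<And>z. R z = (1 - q * z) * R (q * z)"
    using q_product_exists[OF q] by blast
  have e_add: "e (z + w) = e z * e w" for z w
    by (simp add: e_def distrib_left exp_add)
  have e_minus: "e (- z) = 1 / e z" for z
    by (simp add: e_def exp_minus divide_inverse)
  have e_nz [simp]: "e z \<noteq> 0" for z by (simp add: e_def)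
  have e_nat: "e (of_nat n * w) = e w ^ n" for n w
    by (simp add: e_def mult.left_commute flip: exp_of_nat_mult)
  have e_1: "e z = 1 \<longleftrightarrow> (\<exists>m::int. z = of_int m)" for z
  proof -
    have "e z = 1 \<longleftrightarrow> (\<exists>n::int. Re (2 * of_real pi * \<i> * z) = 0 \<and> Im (2 * of_real pi * \<i> * z) = of_int (2 * n) * pi)"
      unfolding e_def exp_eq_1 by simp
    also have "\<dots> \<longleftrightarrow> (\<exists>m::int. z = of_int m)"
      by (auto simp: complex_eq_iff)
    finally show ?thesis .
  qed
  define P where "P = (\<lambda>z. (1 - e z) * R (e z) * R (e (- z)))"
  \<comment> \<open>In the weighted modulus \<open>N\<close> below, the quadratic term cancels the
    dependence on \<open>Re z\<close>, leaving an exponential in \<open>Im z\<close> alone. The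
    linear term is chosen so that its change under the shift by \<open>\<tau>\<close> exactly
    offsets the factor \<open>1 / e z\<close> picked up by \<open>P\<close>.\<close>
  define E where "E = (\<lambda>z. exp (of_real (pi / (2 * t)) * z\<^sup>2 - \<i> * of_real pi * z))"
  define \<sigma> where "\<sigma> = (\<lambda>z. P z * E z)"
  define N where "N = (\<lambda>z. norm (\<sigma> z) * exp (- (pi / (2 * t)) * (norm z)\<^sup>2))"
  have P1: "P (z + 1) = P z" for z
  proof -
    have e1: "e 1 = 1" using e_1[of 1] of_int_1 by metis
    have "e (z + 1) = e z" "e (- (z + 1)) = e (- z)"
      using e1 by (simp_all only: e_add e_minus minus_add_distrib) simp_all
    then show ?thesis by (simp add: P_def)
  qed
  \<comment> \<open>The shift multiplies \<open>e z\<close> by \<open>q\<close> and divides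
    \<open>e (- z)\<close> by \<open>q\<close>, so the functional equation of \<open>R\<close> is
    used once in each direction.\<close>
  have P\<tau>: "P (z + \<tau>) = - P z / e z" for z
  proof -
    have "R (e z) = (1 - e (z + \<tau>)) * R (e (z + \<tau>))"
      using R(3)[of "e z"] by (simp add: e_add q_def mult.commute)
    moreover have "R (e (- (z + \<tau>))) = (1 - e (- z)) * R (e (- z))"
    proof -
      have "q * e (- (z + \<tau>)) = e (- z)"
        unfolding q_def e_add[symmetric] by simp
      then show ?thesis using R(3)[of "e (- (z + \<tau>))"] by simp
    qed
    ultimately have "P (z + \<tau>) = R (e z) * ((1 - e (- z)) * R (e (- z)))"
      by (simp add: P_def)
    also have "1 - e (- z) = - (1 - e z) / e z"
      by (simp add: e_minus field_simps)
    finally show ?thesis by (simp add: P_def field_simps)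
  qed
  have nE: "norm (E z) * exp (- (pi / (2 * t)) * (norm z)\<^sup>2) = exp (pi * Im z - pi / t * (Im z)\<^sup>2)" for z
  proof -
    have "norm (E z) = exp (pi / (2 * t) * ((Re z)\<^sup>2 - (Im z)\<^sup>2) + pi * Im z)"
      unfolding E_def norm_exp_eq_Re by (simp add: power2_eq_square)
    then have "norm (E z) * exp (- (pi / (2 * t)) * (norm z)\<^sup>2) =
      exp (pi / (2 * t) * ((Re z)\<^sup>2 - (Im z)\<^sup>2) + pi * Im z - (pi / (2 * t)) * ((Re z)\<^sup>2 + (Im z)\<^sup>2))"
      by (simp add: cmod_power2 exp_add[symmetric])
    also have "pi / (2 * t) * ((Re z)\<^sup>2 - (Im z)\<^sup>2) + pi * Im z - (pi / (2 * t)) * ((Re z)\<^sup>2 + (Im z)\<^sup>2) =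
      pi * Im z - pi / t * (Im z)\<^sup>2"
      using t0 by (simp add: field_simps)
    finally show ?thesis .
  qed
  have N: "N z = norm (P z) * exp (pi * Im z - pi / t * (Im z)\<^sup>2)" for z
    using nE[of z] by (simp add: N_def \<sigma>_def norm_mult mult.assoc)
  have N1: "N (z + 1) = N z" for z
    by (simp add: N P1)
  have N\<tau>: "N (z + \<tau>) = N z" for z
  proof -
    have "N (z + \<tau>) = norm (P z) * (exp (2 * pi * Im z) * exp (pi * (Im z + t) - pi / t * (Im z + t)\<^sup>2))"
    proof -
      have "norm (P (z + \<tau>)) = norm (P z) * exp (2 * pi * Im z)"
        unfolding P\<tau> by (simp add: e_def norm_mult norm_inverse exp_minus divide_inverse)
      then show ?thesis by (simp add: N t_def)
    qed
    also have "exp (2 * pi * Im z) * exp (pi * (Im z + t) - pi / t * (Im z + t)\<^sup>2) = exp (pi * Im z - pi / t * (Im z)\<^sup>2)"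
      unfolding exp_add[symmetric] using t0 by (simp add: field_simps power2_eq_square)
    finally show ?thesis by (simp add: N)
  qed
  have per: "N (z + w) = N z" if w: "w \<in> shifted_lattice 0 \<tau> 1" for z w
  proof -
    obtain m n where "w = \<tau> * of_int m + 1 * of_int n"
      using w by (auto simp: shifted_lattice_def)
    then show ?thesis
      using periodic_int_multiple[of N, OF N1, of "z + \<tau> * of_int m" n] periodic_int_multiple[of N, OF N\<tau>, of z m]
      by (simp add: add.assoc)
  qed
  have zero: "\<sigma> z = 0 \<longleftrightarrow> z \<in> shifted_lattice 0 \<tau> 1" for z
  proof -
    have R1: "R (e z) = 0 \<longleftrightarrow> (\<exists>n m. z = of_int m - \<tau> * of_nat (Suc n))" for z
    proof -
      have "R (e z) = 0 \<longleftrightarrow> (\<exists>n. e (z + of_nat (Suc n) * \<tau>) = 1)"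
        unfolding R(2) q_def e_nat[symmetric] e_add by (simp only: mult.commute)
      also have "\<dots> \<longleftrightarrow> (\<exists>n m. z = of_int m - \<tau> * of_nat (Suc n))"
        unfolding e_1 by (simp add: eq_diff_eq mult.commute)
      finally show ?thesis .
    qed
    \<comment> \<open>The factors \<open>1 - e z\<close>, \<open>R (e z)\<close> and
      \<open>R (e (- z))\<close> account for the lattice points whose coefficient of
      \<open>\<tau>\<close> is zero, negative and positive, respectively.\<close>
    have "\<sigma> z = 0 \<longleftrightarrow> (\<exists>m. z = of_int m) \<or> (\<exists>n m. z = of_int m - \<tau> * of_nat (Suc n))
        \<or> (\<exists>n m. - z = of_int m - \<tau> * of_nat (Suc n))"
      by (auto simp: \<sigma>_def P_def E_def R1 e_1[symmetric])
    also have "\<dots> \<longleftrightarrow> (\<exists>k m. z = \<tau> * of_int k + of_int m)" (is "?l \<longleftrightarrow> ?r")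
    proof
      assume ?l
      then show ?r
      proof (elim disjE exE)
        fix m :: int assume "z = of_int m"
        then have "z = \<tau> * of_int 0 + of_int m" by simp
        then show ?r by blast
      next
        fix n :: nat and m :: int assume "z = of_int m - \<tau> * of_nat (Suc n)"
        then have "z = \<tau> * of_int (- int (Suc n)) + of_int m" by (simp add: algebra_simps)
        then show ?r by blast
      next
        fix n :: nat and m :: int assume "- z = of_int m - \<tau> * of_nat (Suc n)"
        then have "- (- z) = - (of_int m - \<tau> * of_nat (Suc n))" by (rule arg_cong)
        then have "z = \<tau> * of_int (int (Suc n)) + of_int (- m)" by (simp add: algebra_simps)
        then show ?r by blast
      qed
    next
      assume ?r
      then obtain k m where km: "z = \<tau> * of_int k + of_int m" by blast
      consider "k = 0" | n where "k = - int (Suc n)" | n where "k = int (Suc n)"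
        by (metis int_cases3 gr0_implies_Suc)
      then show ?l
      proof cases
        case 1 then show ?l using km by auto
      next
        case *: (2 n)
        then have "z = of_int m - \<tau> * of_nat (Suc n)" unfolding km * by (simp add: algebra_simps)
        then show ?l by blast
      next
        case *: (3 n)
        then have "- z = of_int (- m) - \<tau> * of_nat (Suc n)" unfolding km * by (simp add: algebra_simps)
        then show ?l by blast
      qed
    qed
    finally show ?thesis by (auto simp: shifted_lattice_def)
  qed
  have hol_e: "e holomorphic_on UNIV" "(\<lambda>z. e (- z)) holomorphic_on UNIV"
    by (auto simp: e_def intro!: holomorphic_intros)
  \<comment> \<open>The cofactor of \<open>1 - e z\<close>, which has a simple zero at 0; the
    derivative of \<open>\<sigma>\<close> at 0 is therefore a nonzero multiple of
    \<open>Q 0\<close>.\<close>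
  define Q where "Q = (\<lambda>z. R (e z) * R (e (- z)) * E z)"
  have hol_Q: "Q holomorphic_on UNIV"
    unfolding Q_def E_def
    using holomorphic_on_compose_gen[OF hol_e(1) R(1)] holomorphic_on_compose_gen[OF hol_e(2) R(1)]
    by (intro holomorphic_intros) (auto simp: o_def)
  have \<sigma>: "\<sigma> = (\<lambda>z. (1 - e z) * Q z)"
    by (auto simp: \<sigma>_def P_def Q_def)
  have hol_\<sigma>: "\<sigma> holomorphic_on UNIV"
    unfolding \<sigma> by (intro holomorphic_intros hol_Q hol_e)
  have "Q 0 \<noteq> 0"
  proof -
    have "R 1 \<noteq> 0"
    proof
      assume "R 1 = 0"
      then obtain n where "q ^ Suc n = 1" using R(2) by auto
      then have "norm q ^ Suc n = 1" by (metis norm_one norm_power)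
      then show False using q power_Suc_less_one[of "norm q" n] by simp
    qed
    then show ?thesis by (simp add: Q_def e_def E_def)
  qed
  have "(\<sigma> has_field_derivative (- (2 * of_real pi * \<i>) * Q 0)) (at 0)"
  proof -
    have "(Q has_field_derivative deriv Q 0) (at 0)"
      using hol_Q by (simp add: holomorphic_derivI)
    then show ?thesis
      unfolding \<sigma> e_def by (auto intro!: derivative_eq_intros)
  qed
  then have "deriv \<sigma> 0 \<noteq> 0"
    using \<open>Q 0 \<noteq> 0\<close> by (simp add: DERIV_imp_deriv)
  with hol_\<sigma> per zero show ?thesis
    using that[of \<sigma>] unfolding N_def t_def by blast
qed

subsection \<open>Interpolation on the lattice\<close>

text \<open>A lower limit controls only some arbitrarily large radii, hence the existential
  \<open>r\<close>. Bounding the whole disc instead of the circle makes the notion stable under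
  affine substitutions.\<close>

definition quadratic_growth :: "real \<Rightarrow> (complex \<Rightarrow> complex) \<Rightarrow> bool" where
  "quadratic_growth c F \<longleftrightarrow> (\<forall>R. \<exists>r\<ge>R. \<forall>z. norm z \<le> r \<longrightarrow> norm (F z) \<le> exp (c * r\<^sup>2))"

text \<open>The gap \<open>(c' - c) * r\<^sup>2\<close> absorbs both a shift of the radius and a
  constant factor.\<close>

lemma eventually_exp_square_le:
  fixes b c c' \<kappa> :: real
  assumes "c < c'" "\<kappa> > 0"
  shows "eventually (\<lambda>r. exp (c * r\<^sup>2) \<le> \<kappa> * exp (c' * (r - b)\<^sup>2)) at_top"
proof -
  have "filterlim (\<lambda>r. - (2 * c' * b) + (c' - c) * r) at_top at_top"
    using assms
    by (intro filterlim_tendsto_add_at_top[OF tendsto_const]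
        filterlim_tendsto_pos_mult_at_top[OF tendsto_const] filterlim_ident) auto
  then have "filterlim (\<lambda>r. r * (- (2 * c' * b) + (c' - c) * r)) at_top at_top"
    by (rule filterlim_at_top_mult_at_top[OF filterlim_ident])
  then have "eventually (\<lambda>r. - ln \<kappa> - c' * b\<^sup>2 \<le> r * (- (2 * c' * b) + (c' - c) * r)) at_top"
    by (simp add: filterlim_at_top)
  then show ?thesis
  proof eventually_elim
    case (elim r)
    have "c * r\<^sup>2 \<le> ln \<kappa> + c' * (r - b)\<^sup>2"
      using elim by (simp add: power2_eq_square algebra_simps)
    then have "exp (c * r\<^sup>2) \<le> exp (ln \<kappa> + c' * (r - b)\<^sup>2)" by simp
    then show ?case using assms by (simp add: exp_add)
  qed
qed

text \<open>With \<open>p = norm b / norm w\<close>, the disc of radius \<open>s - p\<close> is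
  mapped into the disc of radius \<open>norm w * s\<close>. Scaling yields the factor
  \<open>(norm w)\<^sup>2\<close>, and the lost radius \<open>p\<close> is paid for by the strict
  inequality.\<close>

lemma quadratic_growth_affine:
  assumes F: "quadratic_growth c F" and "w \<noteq> 0" "c * (norm w)\<^sup>2 < c'"
  shows "quadratic_growth c' (\<lambda>z. F (b + w * z))"
  unfolding quadratic_growth_def
proof
  fix R
  define p where "p = norm b / norm w"
  obtain R1 where R1: "\<And>s. s \<ge> R1 \<Longrightarrow> exp (c * (norm w)\<^sup>2 * s\<^sup>2) \<le> 1 * exp (c' * (s - p)\<^sup>2)"
    using eventually_exp_square_le[OF assms(3), of 1 p] unfolding eventually_at_top_linorder by auto
  obtain r where r: "r \<ge> norm w * max R1 (R + p)" "\<And>z. norm z \<le> r \<Longrightarrow> norm (F z) \<le> exp (c * r\<^sup>2)"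
    using F unfolding quadratic_growth_def by blast
  define s where "s = r / norm w"
  have "max R1 (R + p) * norm w \<le> r"
    using r(1) by (simp only: mult.commute)
  then have "max R1 (R + p) \<le> s"
    using \<open>w \<noteq> 0\<close> by (simp only: s_def pos_le_divide_eq zero_less_norm_iff not_False_eq_True)
  then have s: "s \<ge> R1" "s \<ge> R + p" "r = norm w * s"
    using \<open>w \<noteq> 0\<close> by (auto simp: s_def)
  show "\<exists>r\<ge>R. \<forall>z. norm z \<le> r \<longrightarrow> norm (F (b + w * z)) \<le> exp (c' * r\<^sup>2)"
  proof (intro exI[of _ "s - p"] conjI allI impI)
    show "R \<le> s - p" using s by simp
    fix z :: complex assume z: "norm z \<le> s - p"
    have "norm (b + w * z) \<le> norm b + norm w * norm z"
      using norm_triangle_ineq[of b "w * z"] by (simp add: norm_mult)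
    also have "\<dots> \<le> norm b + norm w * (s - p)"
      using z by (intro add_mono mult_left_mono) auto
    also have "\<dots> = r" using \<open>w \<noteq> 0\<close> by (simp add: s(3) p_def field_simps)
    finally have "norm (F (b + w * z)) \<le> exp (c * r\<^sup>2)" by (rule r(2))
    also have "\<dots> \<le> exp (c' * (s - p)\<^sup>2)"
      using R1[OF s(1)] by (simp add: s(3) power_mult_distrib mult_ac)
    finally show "norm (F (b + w * z)) \<le> exp (c' * (s - p)\<^sup>2)" .
  qed
qed

text \<open>The nonnegative and the negative indices are each dominated by one geometric series of
  ratio \<open>exp (- 1)\<close>.\<close>

lemma sum_exp_abs_int_le:
  assumes "finite I"
  shows "(\<Sum>n\<in>I. exp (- \<bar>real_of_int n\<bar>)) \<le> 2 / (1 - exp (- 1))"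
proof -
  have half: "(\<Sum>n\<in>J. exp (- \<bar>real_of_int n\<bar>)) \<le> 1 / (1 - exp (- 1))"
    if "finite J" "inj_on (nat \<circ> abs) J" for J
  proof -
    have "(\<Sum>n\<in>J. exp (- \<bar>real_of_int n\<bar>)) = (\<Sum>n\<in>J. exp (- 1) ^ (nat \<circ> abs) n)"
      by (intro sum.cong) (auto simp: exp_of_nat_mult[symmetric])
    also have "\<dots> = (\<Sum>j\<in>(nat \<circ> abs) ` J. exp (- 1) ^ j)"
      using that by (subst sum.reindex) auto
    also have "\<dots> \<le> (\<Sum>j. exp (- 1) ^ j)"
      using that by (intro sum_le_suminf summable_geometric) auto
    also have "\<dots> = 1 / (1 - exp (- 1))"
      by (intro suminf_geometric) auto
    finally show ?thesis .
  qed
  have "(\<Sum>n\<in>I. exp (- \<bar>real_of_int n\<bar>)) =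
      (\<Sum>n\<in>I \<inter> {0..}. exp (- \<bar>real_of_int n\<bar>)) + (\<Sum>n\<in>I \<inter> {..<0}. exp (- \<bar>real_of_int n\<bar>))"
    using assms by (subst sum.union_disjoint[symmetric]) (auto intro!: sum.cong)
  also have "\<dots> \<le> 1 / (1 - exp (- 1)) + 1 / (1 - exp (- 1))"
    using assms by (intro add_mono half) (auto simp: inj_on_def)
  finally show ?thesis by simp
qed

section \<open>Geometry of the lattice\<close>

locale upper_lattice =
  fixes \<tau> :: complex
  assumes Im_pos: "Im \<tau> > 0"
begin

abbreviation "L \<equiv> shifted_lattice 0 \<tau> 1"

lemma latticeI: "\<tau> * of_int m + of_int n \<in> L"
  by (auto simp: shifted_lattice_def)

lemma latticeE:
  assumes "z \<in> L"
  obtains m n where "z = \<tau> * of_int m + of_int n"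
  using assms by (auto simp: shifted_lattice_def)

lemma lattice_add: "z \<in> L \<Longrightarrow> w \<in> L \<Longrightarrow> z + w \<in> L"
proof (elim latticeE)
  fix m n m' n' assume "z = \<tau> * of_int m + of_int n" "w = \<tau> * of_int m' + of_int n'"
  then show "z + w \<in> L" using latticeI[of "m + m'" "n + n'"] by (simp add: algebra_simps)
qed

lemma lattice_minus: "z \<in> L \<Longrightarrow> - z \<in> L"
proof (elim latticeE)
  fix m n assume "z = \<tau> * of_int m + of_int n"
  then show "- z \<in> L" using latticeI[of "- m" "- n"] by (simp add: algebra_simps)
qed

lemma lattice_diff: "z \<in> L \<Longrightarrow> w \<in> L \<Longrightarrow> z - w \<in> L"
  using lattice_add[of z "- w"] lattice_minus[of w] by simp

text \<open>The reciprocal of the constant in \<open>coordinates_le_norm\<close>. As a nonzero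
  lattice point has a nonzero integer coordinate, \<open>sep\<close> also bounds the distance of
  distinct lattice points from below; it need not be the minimal distance.\<close>

definition sep :: real where
  "sep = 1 / (1 + (1 + norm \<tau>) / Im \<tau>)"

lemma sep_pos: "sep > 0"
  using Im_pos by (simp add: sep_def add_pos_nonneg)

text \<open>The imaginary part controls \<open>m\<close>; subtracting
  \<open>\<tau> * of_int m\<close> then controls \<open>n\<close>.\<close>

lemma coordinates_le_norm:
  "\<bar>real_of_int m\<bar> + \<bar>real_of_int n\<bar> \<le> norm (\<tau> * of_int m + of_int n) / sep"
proof -
  let ?z = "\<tau> * of_int m + of_int n"
  have "Im \<tau> * \<bar>real_of_int m\<bar> = \<bar>Im ?z\<bar>" using Im_pos by (simp add: abs_mult)
  then have m: "\<bar>real_of_int m\<bar> \<le> norm ?z / Im \<tau>"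
    using Im_pos abs_Im_le_cmod[of ?z] by (simp add: field_simps)
  have "\<bar>real_of_int n\<bar> = norm (?z - \<tau> * of_int m)" by simp
  also have "\<dots> \<le> norm ?z + norm \<tau> * \<bar>real_of_int m\<bar>"
    using norm_triangle_ineq4[of ?z "\<tau> * of_int m"] by (simp add: norm_mult)
  also have "\<dots> \<le> norm ?z + norm \<tau> * (norm ?z / Im \<tau>)"
    using m by (intro add_mono mult_left_mono) auto
  finally have "\<bar>real_of_int m\<bar> + \<bar>real_of_int n\<bar> \<le> norm ?z / Im \<tau> + (norm ?z + norm \<tau> * (norm ?z / Im \<tau>))"
    using m by linarith
  also have "\<dots> = norm ?z / sep" using Im_pos by (simp add: sep_def field_simps)
  finally show ?thesis .
qed

lemma lattice_separated:
  assumes "z \<in> L" "w \<in> L" "z \<noteq> w"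
  shows "sep \<le> norm (z - w)"
proof -
  obtain m n where mn: "z - w = \<tau> * of_int m + of_int n"
    using lattice_diff[OF assms(1,2)] by (rule latticeE)
  then have "m \<noteq> 0 \<or> n \<noteq> 0" using assms(3) by auto
  then have "1 \<le> \<bar>real_of_int m\<bar> + \<bar>real_of_int n\<bar>" by linarith
  also have "\<dots> \<le> norm (z - w) / sep" unfolding mn by (rule coordinates_le_norm)
  finally show ?thesis using sep_pos by (simp add: field_simps)
qed

lemma closed_lattice_subset: "Y \<subseteq> L \<Longrightarrow> closed Y"
  using sep_pos lattice_separated
  by (intro discrete_imp_closed[of sep Y]) (force simp: dist_norm)+

lemma finite_lattice_ball: "finite {z \<in> L. norm z < r}"
proof -
  define N where "N = \<lceil>r / sep\<rceil>"
  have "{z \<in> L. norm z < r} \<subseteq> (\<lambda>(m, n). \<tau> * of_int m + of_int n) ` ({- N..N} \<times> {- N..N})"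
  proof
    fix z assume z: "z \<in> {z \<in> L. norm z < r}"
    then obtain m n where mn: "z = \<tau> * of_int m + of_int n" by (auto elim: latticeE)
    have "norm z / sep \<le> r / sep" using z sep_pos by (simp add: divide_right_mono)
    then have "\<bar>real_of_int m\<bar> + \<bar>real_of_int n\<bar> \<le> of_int N"
      using coordinates_le_norm[of m n] unfolding mn N_def by linarith
    then have "\<bar>m\<bar> \<le> N" "\<bar>n\<bar> \<le> N" by linarith+
    then show "z \<in> (\<lambda>(m, n). \<tau> * of_int m + of_int n) ` ({- N..N} \<times> {- N..N})"
      unfolding mn by (intro image_eqI[of _ _ "(m, n)"]) auto
  qed
  then show ?thesis by (rule finite_subset) auto
qed

text \<open>Rounding down first the row and then the position within the row leaves a remainder in a
  box of sides 1 and \<open>Im \<tau>\<close>.\<close>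

lemma lattice_near:
  obtains w where "w \<in> L" "norm (z - w) \<le> 1 + Im \<tau>"
proof -
  define m where "m = \<lfloor>Im z / Im \<tau>\<rfloor>"
  define n where "n = \<lfloor>Re (z - \<tau> * of_int m)\<rfloor>"
  define d where "d = z - (\<tau> * of_int m + of_int n)"
  have "of_int m \<le> Im z / Im \<tau>" "Im z / Im \<tau> < of_int m + 1"
    unfolding m_def by linarith+
  then have "0 \<le> Im d" "Im d \<le> Im \<tau>"
    using Im_pos by (auto simp: d_def field_simps)
  moreover have "0 \<le> Re d" "Re d \<le> 1"
    unfolding d_def n_def by (simp, linarith)+
  ultimately have "norm d \<le> 1 + Im \<tau>" using cmod_le[of d] by linarith
  then show ?thesis using that[OF latticeI] unfolding d_def by blast
qed

text \<open>Completing the square dominates each term by a multiple of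
  \<open>exp (- norm w / sep)\<close>, which \<open>coordinates_le_norm\<close> splits into one
  factor per coordinate. A bound uniform in finite \<open>X\<close> suffices, since only finitely
  many nodes are interpolated at a time.\<close>

lemma gaussian_lattice_sum_bounded:
  assumes "A > 0"
  obtains K where "\<And>X. finite X \<Longrightarrow> X \<subseteq> L \<Longrightarrow> (\<Sum>w\<in>X. exp (k * norm w - A * (norm w)\<^sup>2)) \<le> K"
proof -
  \<comment> \<open>The maximum of \<open>(k + 1 / sep) * x - A * x\<^sup>2\<close> over real
    \<open>x\<close>.\<close>
  define c where "c = (k + 1 / sep)\<^sup>2 / (4 * A)"
  have exponent: "k * norm w - A * (norm w)\<^sup>2 \<le> c - norm w / sep" for w :: complex
  proof -
    have "0 \<le> A * (norm w - (k + 1 / sep) / (2 * A))\<^sup>2" using assms by simp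
    also have "\<dots> = A * (norm w)\<^sup>2 - (k + 1 / sep) * norm w + c"
      using assms by (simp add: c_def power2_eq_square field_simps)
    finally show ?thesis by (simp add: algebra_simps)
  qed
  define e where "e = (\<lambda>n::int. exp (- \<bar>real_of_int n\<bar>))"
  show ?thesis
  proof (rule that)
    fix X assume X: "finite X" "X \<subseteq> L"
    define pt where "pt = (\<lambda>(m, n). \<tau> * of_int m + of_int n)"
    have "X \<subseteq> range pt"
    proof
      fix z assume "z \<in> X"
      then have "z \<in> L" using X(2) by blast
      then obtain m n where "z = \<tau> * of_int m + of_int n" by (rule latticeE)
      then have "z = pt (m, n)" by (simp add: pt_def)
      then show "z \<in> range pt" by blast
    qed
    then obtain Y where Y: "finite Y" "X = pt ` Y"
      using finite_subset_image[OF X(1)] by blast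
    \<comment> \<open>Enlarging the index set to a full square lets the double sum factor.\<close>
    define I where "I = fst ` Y \<union> snd ` Y"
    have I: "finite I" "Y \<subseteq> I \<times> I" using Y(1) by (force simp: I_def)+
    have "(\<Sum>w\<in>X. exp (k * norm w - A * (norm w)\<^sup>2)) \<le> (\<Sum>y\<in>Y. exp (k * norm (pt y) - A * (norm (pt y))\<^sup>2))"
      unfolding Y(2)
      using sum_image_le[OF Y(1), of "\<lambda>w. exp (k * norm w - A * (norm w)\<^sup>2)" pt] by (simp add: o_def)
    also have "\<dots> \<le> (\<Sum>(m, n)\<in>Y. exp c * (e m * e n))"
    proof (rule sum_mono, clarify)
      fix m n
      have "k * norm (pt (m, n)) - A * (norm (pt (m, n)))\<^sup>2 \<le> c - (\<bar>real_of_int m\<bar> + \<bar>real_of_int n\<bar>)"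
        using exponent[of "pt (m, n)"] coordinates_le_norm[of m n] by (simp add: pt_def)
      then show "exp (k * norm (pt (m, n)) - A * (norm (pt (m, n)))\<^sup>2) \<le> exp c * (e m * e n)"
        by (simp add: e_def exp_add[symmetric])
    qed
    also have "\<dots> \<le> (\<Sum>(m, n)\<in>I \<times> I. exp c * (e m * e n))"
      using I by (intro sum_mono2) (auto simp: e_def)
    also have "\<dots> = exp c * ((\<Sum>m\<in>I. e m) * (\<Sum>n\<in>I. e n))"
    proof -
      have *: "(\<Sum>m\<in>I. e m) * (\<Sum>n\<in>I. e n) = (\<Sum>(m, n)\<in>I \<times> I. e m * e n)"
        by (simp only: sum_product sum.cartesian_product)
      then show ?thesis
        by (simp only: *) (simp add: sum_distrib_left case_prod_beta)
    qed
    also have "\<dots> \<le> exp c * ((2 / (1 - exp (- 1))) * (2 / (1 - exp (- 1))))"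
      using sum_exp_abs_int_le[OF I(1)]
      by (intro mult_left_mono mult_mono) (auto simp: e_def intro!: sum_nonneg)
    finally show "(\<Sum>w\<in>X. exp (k * norm w - A * (norm w)\<^sup>2)) \<le> exp c * ((2 / (1 - exp (- 1))) * (2 / (1 - exp (- 1))))" .
  qed
qed

end

text \<open>The interface between the construction of \<open>\<sigma>\<close> and the interpolation.
  It is later instantiated with \<open>A = pi / (2 * Im \<tau>)\<close>, the rate with which the
  growth of the interpolated function is compared.\<close>

locale sigma_function = upper_lattice +
  fixes \<sigma> :: "complex \<Rightarrow> complex" and A :: real
  assumes A_pos: "A > 0"
    and hol: "\<sigma> holomorphic_on UNIV"
    and quasi_periodic: "\<And>z w. w \<in> L \<Longrightarrow>
      norm (\<sigma> (z + w)) * exp (- A * (norm (z + w))\<^sup>2) = norm (\<sigma> z) * exp (- A * (norm z)\<^sup>2)"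
    and zero_iff: "\<And>z. \<sigma> z = 0 \<longleftrightarrow> z \<in> L"
    and deriv_0: "deriv \<sigma> 0 \<noteq> 0"
begin

text \<open>Divide \<open>quasi_periodic\<close> by the norm of a small displacement
  \<open>h\<close> and let \<open>h\<close> tend to 0. This gives the size of the denominators in
  the Lagrange basis.\<close>

lemma norm_deriv_lattice:
  assumes w: "w \<in> L"
  shows "norm (deriv \<sigma> w) = norm (deriv \<sigma> 0) * exp (A * (norm w)\<^sup>2)"
proof -
  have L0: "0 \<in> L" using latticeI[of 0 0] by simp
  have lim: "((\<lambda>h. norm (\<sigma> (z + h) / h)) \<longlongrightarrow> norm (deriv \<sigma> z)) (at 0)" if "z \<in> L" for z
  proof -
    have "(\<sigma> has_field_derivative deriv \<sigma> z) (at z)"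
      using hol by (simp add: holomorphic_derivI)
    moreover have "\<sigma> z = 0" using zero_iff that by blast
    ultimately show ?thesis
      unfolding DERIV_def by (intro tendsto_norm) simp
  qed
  have "((\<lambda>h. norm (\<sigma> (0 + h) / h) * exp (A * ((norm (h + w))\<^sup>2 - (norm h)\<^sup>2)))
      \<longlongrightarrow> norm (deriv \<sigma> 0) * exp (A * ((norm (0 + w))\<^sup>2 - (norm (0::complex))\<^sup>2))) (at 0)"
    by (intro tendsto_intros lim L0)
  moreover have "norm (\<sigma> (0 + h) / h) * exp (A * ((norm (h + w))\<^sup>2 - (norm h)\<^sup>2)) = norm (\<sigma> (w + h) / h)" for h
  proof -
    have "norm (\<sigma> h) * exp (A * ((norm (h + w))\<^sup>2 - (norm h)\<^sup>2)) =
        (norm (\<sigma> h) * exp (- A * (norm h)\<^sup>2)) * exp (A * (norm (h + w))\<^sup>2)"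
      by (simp add: right_diff_distrib exp_diff exp_minus divide_inverse)
    also have "\<dots> = norm (\<sigma> (w + h))"
      unfolding quasi_periodic[OF w, of h, symmetric] by (simp add: exp_minus add.commute)
    finally show ?thesis by (simp add: norm_divide)
  qed
  ultimately have "((\<lambda>h. norm (\<sigma> (w + h) / h)) \<longlongrightarrow> norm (deriv \<sigma> 0) * exp (A * (norm w)\<^sup>2)) (at 0)"
    by simp
  then show ?thesis using lim[OF w] by (metis tendsto_unique at_neq_bot)
qed

text \<open>The weighted modulus \<open>\<Phi>\<close> is invariant under lattice shifts, so its
  minimum over a compact set of representatives bounds it everywhere.\<close>

lemma lower_bound_off_lattice:
  assumes "\<delta> > 0"
  obtains c where "c > 0"
    "\<And>z. (\<And>w. w \<in> L \<Longrightarrow> \<delta> \<le> norm (z - w)) \<Longrightarrow> c * exp (A * (norm z)\<^sup>2) \<le> norm (\<sigma> z)"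
proof -
  define K where "K = cball 0 (1 + Im \<tau>) \<inter> (\<Inter>w\<in>L. {z. \<delta> \<le> norm (z - w)})"
  define \<Phi> where "\<Phi> = (\<lambda>z. norm (\<sigma> z) * exp (- A * (norm z)\<^sup>2))"
  have "compact K"
    unfolding K_def by (intro compact_Int_closed compact_cball closed_INT ballI closed_Collect_le continuous_intros)
  have "continuous_on K \<Phi>"
    unfolding \<Phi>_def by (intro continuous_intros continuous_on_subset[OF holomorphic_on_imp_continuous_on[OF hol]]) auto
  have K_pos: "\<Phi> z > 0" if "z \<in> K" for z
  proof -
    have "z \<notin> L" using that assms by (force simp: K_def)
    then show ?thesis using zero_iff by (simp add: \<Phi>_def)
  qed
  obtain c where c: "c > 0" "\<And>z. z \<in> K \<Longrightarrow> c \<le> \<Phi> z"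
  \<comment> \<open>For large \<open>\<delta>\<close> the set \<open>K\<close> can be empty; then no
    point satisfies the distance condition and any constant serves.\<close>
  proof (cases "K = {}")
    case True
    then show ?thesis using that[of 1] by simp
  next
    case False
    then obtain x where "x \<in> K" "\<And>z. z \<in> K \<Longrightarrow> \<Phi> x \<le> \<Phi> z"
      using continuous_attains_inf[OF \<open>compact K\<close> _ \<open>continuous_on K \<Phi>\<close>] by blast
    then show ?thesis using that[of "\<Phi> x"] K_pos by blast
  qed
  show ?thesis
  proof (rule that[OF c(1)])
    fix z assume z: "\<And>w. w \<in> L \<Longrightarrow> \<delta> \<le> norm (z - w)"
    obtain u where u: "u \<in> L" "norm (z - u) \<le> 1 + Im \<tau>" by (rule lattice_near)
    have "\<delta> \<le> norm (z - u - w)" if "w \<in> L" for w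
      using z[OF lattice_add[OF u(1) that]] by (simp add: algebra_simps)
    then have "z - u \<in> K" using u(2) by (auto simp: K_def)
    then have "c \<le> \<Phi> (z - u)" by (rule c(2))
    also have "\<dots> = \<Phi> z" using quasi_periodic[OF u(1), of "z - u"] by (simp add: \<Phi>_def)
    finally show "c * exp (A * (norm z)\<^sup>2) \<le> norm (\<sigma> z)"
      by (simp add: \<Phi>_def exp_minus field_simps)
  qed
qed

definition lagrange :: "complex \<Rightarrow> complex \<Rightarrow> complex" where
  "lagrange w z = (if z = w then 1 else \<sigma> z / (deriv \<sigma> w * (z - w)))"

lemma deriv_lattice_nonzero: "w \<in> L \<Longrightarrow> deriv \<sigma> w \<noteq> 0"
  using norm_deriv_lattice[of w] deriv_0 by auto

lemma lagrange_holomorphic: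
  assumes w: "w \<in> L"
  shows "lagrange w holomorphic_on UNIV"
proof -
  have "(\<lambda>z. (if z = w then deriv \<sigma> w else (\<sigma> z - \<sigma> w) / (z - w)) / deriv \<sigma> w) holomorphic_on UNIV"
    by (intro holomorphic_intros pole_lemma hol) (auto simp: deriv_lattice_nonzero[OF w])
  moreover have "\<sigma> w = 0" using zero_iff w by blast
  ultimately show ?thesis
    by (elim holomorphic_transform) (auto simp: lagrange_def deriv_lattice_nonzero[OF w] mult.commute)
qed

lemma lagrange_lattice: "v \<in> L \<Longrightarrow> lagrange w v = (if v = w then 1 else 0)"
  using zero_iff by (simp add: lagrange_def)

text \<open>Let \<open>P\<close> interpolate \<open>F\<close> at the lattice points of a large
  region. Then \<open>(F - P) / \<sigma>\<close> is holomorphic there; on the frontier the growth of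
  \<open>F\<close> is beaten by \<open>\<sigma>\<close>, while \<open>P / \<sigma>\<close> is
  bounded by a Gaussian sum. The maximum principle carries this to \<open>z\<close>. The resulting
  bound does not depend on \<open>c\<close> or the region.\<close>

lemma interpolation_bound:
  assumes F: "F holomorphic_on UNIV" and growth: "quadratic_growth c F" and "c < A"
    and M: "0 \<le> M" "\<And>w. w \<in> L \<Longrightarrow> norm (F w) \<le> M * exp (k * norm w)"
    and \<delta>: "0 < \<delta>" "3 * \<delta> \<le> sep" and z: "\<And>w. w \<in> L \<Longrightarrow> \<delta> \<le> norm (z - w)"
    and K: "\<And>X. finite X \<Longrightarrow> X \<subseteq> L \<Longrightarrow> (\<Sum>w\<in>X. exp (k * norm w - A * (norm w)\<^sup>2)) \<le> K"
  shows "norm (F z) \<le> norm (\<sigma> z) * (1 + 2 * (M * K / (norm (deriv \<sigma> 0) * \<delta>)))"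
proof -
  define B where "B = M * K / (norm (deriv \<sigma> 0) * \<delta>)"
  obtain c1 where c1: "c1 > 0"
    "\<And>z. (\<And>w. w \<in> L \<Longrightarrow> \<delta> \<le> norm (z - w)) \<Longrightarrow> c1 * exp (A * (norm z)\<^sup>2) \<le> norm (\<sigma> z)"
    using lower_bound_off_lattice[OF \<delta>(1)] by blast
  obtain R where R: "\<And>r. r \<ge> R \<Longrightarrow> exp (c * r\<^sup>2) \<le> c1 * exp (A * (r - 2 * \<delta>)\<^sup>2)"
    using eventually_exp_square_le[OF \<open>c < A\<close> c1(1), of "2 * \<delta>"]
    unfolding eventually_at_top_linorder by auto
  obtain r where r: "r \<ge> max R (norm z + 2 * \<delta> + 1)" "\<And>z. norm z \<le> r \<Longrightarrow> norm (F z) \<le> exp (c * r\<^sup>2)"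
    using growth unfolding quadratic_growth_def by blast
  \<comment> \<open>The margin leaves room for discs of radius \<open>\<delta>\<close> about points
    of norm below \<open>\<rho> + \<delta>\<close>: they stay within radius
    \<open>r\<close>.\<close>
  define \<rho> where "\<rho> = r - 2 * \<delta>"
  have \<rho>: "norm z < \<rho>" "0 < \<rho>" using r(1) norm_ge_zero[of z] by (auto simp: \<rho>_def simp del: norm_ge_zero)
  define X where "X = {w \<in> L. norm w < \<rho> + \<delta>}"
  have X: "finite X" "X \<subseteq> L"
    unfolding X_def using finite_lattice_ball by auto
  \<comment> \<open>A disc whose boundary is pushed off the lattice, so that the maximum principle applies to
    \<open>(F - P) / \<sigma>\<close> with \<open>\<sigma>\<close> bounded below on the frontier.\<close>
  define S where "S = ball 0 \<rho> \<union> (\<Union>w\<in>X. ball w \<delta>)"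
  define S' where "S' = cball 0 \<rho> \<union> (\<Union>w\<in>X. cball w \<delta>)"
  have "open S" unfolding S_def by auto
  have "closed S'" unfolding S'_def using X by (intro closed_Un closed_UN) auto
  then have clS: "closure S \<subseteq> S'" by (intro closure_minimal) (auto simp: S_def S'_def dest: less_imp_le)
  \<comment> \<open>An open set whose only lattice points are nodes, so that every zero of
    \<open>\<sigma>\<close> in it is cancelled by \<open>F - P\<close>.\<close>
  define T where "T = - (L - X)"
  have "open T" unfolding T_def by (intro open_Compl closed_lattice_subset) auto
  have T_lattice: "T \<inter> L \<subseteq> X" by (auto simp: T_def)
  have "S' \<subseteq> T"
  proof (unfold T_def, intro subsetI ComplI)
    fix v assume v: "v \<in> S'" "v \<in> L - X"
    then have "norm v > \<rho>" using \<delta> by (auto simp: X_def)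
    then obtain w where w: "w \<in> X" "norm (v - w) \<le> \<delta>" using v by (auto simp: S'_def dist_norm norm_minus_commute)
    then have "v \<noteq> w" using v by auto
    then have "sep \<le> norm (v - w)" using v w X(2) by (intro lattice_separated) auto
    then show False using w \<delta> by linarith
  qed
  define P where "P = (\<lambda>v. \<Sum>w\<in>X. F w * lagrange w v)"
  have hol_P: "P holomorphic_on UNIV"
    unfolding P_def using X(2) by (intro holomorphic_intros lagrange_holomorphic) auto
  \<comment> \<open>The derivative of \<open>\<sigma>\<close> at the node \<open>w\<close>
    contributes \<open>exp (- A * (norm w)\<^sup>2)\<close>, so the sum is at most \<open>K\<close>,
    however large \<open>X\<close> is.\<close>
  have P_bound: "norm (P v) \<le> norm (\<sigma> v) * B" if v: "\<And>w. w \<in> L \<Longrightarrow> \<delta> \<le> norm (v - w)" for v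
  proof -
    have "norm (P v) \<le> (\<Sum>w\<in>X. norm (F w * lagrange w v))" unfolding P_def by (rule norm_sum)
    also have "\<dots> \<le> (\<Sum>w\<in>X. norm (\<sigma> v) * (M / (norm (deriv \<sigma> 0) * \<delta>)) * exp (k * norm w - A * (norm w)\<^sup>2))"
    proof (rule sum_mono)
      fix w assume "w \<in> X"
      then have w: "w \<in> L" using X by auto
      have "v \<noteq> w" using v[OF w] \<delta> by auto
      then have "norm (F w * lagrange w v) = norm (F w) * norm (\<sigma> v) / (norm (deriv \<sigma> 0) * exp (A * (norm w)\<^sup>2) * norm (v - w))"
        by (simp add: lagrange_def norm_mult norm_divide norm_deriv_lattice[OF w])
      also have "\<dots> \<le> (M * exp (k * norm w)) * norm (\<sigma> v) / (norm (deriv \<sigma> 0) * exp (A * (norm w)\<^sup>2) * \<delta>)"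
        using M \<delta> deriv_0 v[OF w] w by (intro frac_le mult_right_mono mult_left_mono mult_nonneg_nonneg) auto
      also have "\<dots> = norm (\<sigma> v) * (M / (norm (deriv \<sigma> 0) * \<delta>)) * exp (k * norm w - A * (norm w)\<^sup>2)"
        by (simp add: exp_diff mult_ac)
      finally show "norm (F w * lagrange w v) \<le> norm (\<sigma> v) * (M / (norm (deriv \<sigma> 0) * \<delta>)) * exp (k * norm w - A * (norm w)\<^sup>2)" .
    qed
    also have "\<dots> = norm (\<sigma> v) * (M / (norm (deriv \<sigma> 0) * \<delta>)) * (\<Sum>w\<in>X. exp (k * norm w - A * (norm w)\<^sup>2))"
      by (rule sum_distrib_left[symmetric])
    also have "\<dots> \<le> norm (\<sigma> v) * (M / (norm (deriv \<sigma> 0) * \<delta>)) * K"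
      using M \<delta> by (intro mult_left_mono K X) auto
    finally show ?thesis by (simp add: B_def)
  qed
  define G where "G = (\<lambda>v. F v - P v)"
  have hol_G: "G holomorphic_on UNIV" unfolding G_def by (intro holomorphic_intros F hol_P)
  have G_zero: "G v = 0 \<and> deriv \<sigma> v \<noteq> 0" if "v \<in> T" "\<sigma> v = 0" for v
  proof -
    have v: "v \<in> X" "v \<in> L" using that zero_iff T_lattice by auto
    have "P v = (\<Sum>w\<in>X. if v = w then F w else 0)"
      unfolding P_def by (intro sum.cong) (auto simp: lagrange_lattice[OF v(2)])
    also have "\<dots> = F v" using v X by simp
    finally show ?thesis using deriv_lattice_nonzero[OF v(2)] by (simp add: G_def)
  qed
  obtain q where q: "q holomorphic_on T" "\<And>v. v \<in> T \<Longrightarrow> G v = q v * \<sigma> v"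
    using holomorphic_quotient_simple_zeros[OF hol_G hol \<open>open T\<close> G_zero] by blast
  have "norm (q z) \<le> 1 + B"
  proof (rule maximum_modulus_frontier[where f = q and S = S and \<xi> = z])
    show "z \<in> S" using \<rho> by (simp add: S_def)
    show "bounded S" unfolding S_def using X by (intro bounded_Un[THEN iffD2] conjI bounded_UN) auto
    show "q holomorphic_on interior S"
      by (rule holomorphic_on_subset[OF q(1)]) (use clS \<open>S' \<subseteq> T\<close> closure_subset interior_subset in blast)
    show "continuous_on (closure S) q"
      by (rule continuous_on_subset[OF holomorphic_on_imp_continuous_on[OF q(1)]]) (use clS \<open>S' \<subseteq> T\<close> in blast)
    fix v assume "v \<in> frontier S"
    then have v: "v \<in> S'" "v \<in> T" "v \<notin> S"
      using clS \<open>S' \<subseteq> T\<close> \<open>open S\<close> by (auto simp: frontier_def interior_open)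
    \<comment> \<open>A node is at distance at least \<open>\<delta>\<close> because its disc lies
      in \<open>S\<close>. Any other lattice point is far from the central disc by its norm, and
      from a disc about a node because \<open>3 * \<delta> \<le> sep\<close>.\<close>
    have off: "\<delta> \<le> norm (v - w)" if w: "w \<in> L" for w
    proof (cases "w \<in> X")
      case True
      then show ?thesis using v(3) by (auto simp: S_def dist_norm norm_minus_commute)
    next
      case False
      then have far: "\<rho> + \<delta> \<le> norm w" using w by (simp add: X_def)
      show ?thesis
      proof (cases "norm v \<le> \<rho>")
        case True
        then show ?thesis using far norm_triangle_ineq3[of v w] by linarith
      next
        case nv: False
        then obtain u where u: "u \<in> X" "norm (v - u) \<le> \<delta>"
          using v(1) by (auto simp: S'_def dist_norm norm_minus_commute)
        then have "sep \<le> norm (w - u)" using w X(2) False by (intro lattice_separated) auto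
        also have "\<dots> \<le> norm (v - w) + norm (v - u)"
          using norm_triangle_ineq4[of "v - u" "v - w"] by simp
        finally show ?thesis using u \<delta> by linarith
      qed
    qed
    have nv: "\<rho> \<le> norm v" using v(3) by (auto simp: S_def)
    have "norm v \<le> r"
    proof (cases "norm v \<le> \<rho>")
      case True
      then show ?thesis using \<delta> by (simp add: \<rho>_def)
    next
      case False
      then obtain u where u: "u \<in> X" "norm (v - u) \<le> \<delta>"
        using v(1) by (auto simp: S'_def dist_norm norm_minus_commute)
      then have "norm u < \<rho> + \<delta>" by (simp add: X_def)
      then show ?thesis using u(2) norm_triangle_ineq2[of v u] by (simp add: \<rho>_def)
    qed
    \<comment> \<open>Here \<open>c < A\<close> enters: at the chosen radius the bound for
      \<open>F\<close> falls below the lower bound for \<open>\<sigma>\<close>.\<close>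
    then have "norm (F v) \<le> exp (c * r\<^sup>2)" by (rule r(2))
    also have "\<dots> \<le> c1 * exp (A * \<rho>\<^sup>2)" using R[of r] r(1) by (simp add: \<rho>_def)
    also have "\<dots> \<le> c1 * exp (A * (norm v)\<^sup>2)"
      using c1(1) A_pos nv \<rho> by (auto intro!: mult_left_mono power_mono)
    also have "\<dots> \<le> norm (\<sigma> v)" by (intro c1(2) off)
    finally have "norm (G v) \<le> norm (\<sigma> v) + norm (\<sigma> v) * B"
      using norm_triangle_ineq4[of "F v" "P v"] P_bound[OF off] by (simp add: G_def)
    then have "norm (q v) * norm (\<sigma> v) \<le> (1 + B) * norm (\<sigma> v)"
      using q(2)[OF v(2)] by (simp add: norm_mult algebra_simps)
    moreover have "norm (\<sigma> v) > 0"
      using zero_iff off[of v] \<delta> by force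
    ultimately show "norm (q v) \<le> 1 + B" by simp
  qed
  moreover have "z \<in> T" using z \<delta> \<open>S' \<subseteq> T\<close> \<rho> by (auto simp: S'_def)
  ultimately have "norm (G z) \<le> (1 + B) * norm (\<sigma> z)"
    using q(2)[of z] by (simp add: norm_mult mult_right_mono)
  moreover have "norm (F z) \<le> norm (G z) + norm (P z)"
    using norm_triangle_ineq[of "G z" "P z"] by (simp add: G_def)
  ultimately have "norm (F z) \<le> norm (\<sigma> z) * (1 + 2 * B)"
    using P_bound[OF z] by (simp add: algebra_simps)
  then show ?thesis by (simp only: B_def)
qed

text \<open>The interpolation bound is applied to the lattice translates of \<open>F\<close> on one fixed circle.\<close>

lemma exponential_type_of_lattice_bound:
  assumes F: "F holomorphic_on UNIV" and growth: "quadratic_growth c F" and "c < A"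
    and k: "0 \<le> k" and M: "\<And>w. w \<in> L \<Longrightarrow> norm (F w) \<le> M * exp (k * norm w)"
  obtains C where "\<And>z. norm (F z) \<le> C * exp (k * norm z)"
proof -
  have M0: "M \<ge> 0" using M[OF latticeI[of 0 0]] order_trans[OF norm_ge_zero] by auto
  obtain K where K: "\<And>X. finite X \<Longrightarrow> X \<subseteq> L \<Longrightarrow> (\<Sum>w\<in>X. exp (k * norm w - A * (norm w)\<^sup>2)) \<le> K"
    using gaussian_lattice_sum_bounded[OF A_pos] by blast
  have K0: "K \<ge> 0" using K[of "{}"] by simp
  define R0 where "R0 = 1 + Im \<tau>"
  \<comment> \<open>Only finitely many lattice points have norm below \<open>R0 + 1\<close>, so some
    circle in this range avoids the lattice; as \<open>R > R0\<close>, it encloses the reduced point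
    \<open>z - u\<close> for every \<open>z\<close>.\<close>
  obtain R where R: "R0 < R" "R < R0 + 1" "R \<notin> norm ` {w \<in> L. norm w < R0 + 1}"
  proof -
    have "infinite {R0<..<R0 + 1}" by (simp add: infinite_Ioo)
    then have "infinite ({R0<..<R0 + 1} - norm ` {w \<in> L. norm w < R0 + 1})"
      using finite_lattice_ball by (intro Diff_infinite_finite) auto
    then show ?thesis using that by (metis (no_types, lifting) Diff_iff finite.emptyI greaterThanLessThan_iff ex_in_conv)
  qed
  have "sphere 0 R \<inter> L = {}" using R by force
  then obtain d where d: "d > 0" "\<And>z w. z \<in> sphere 0 R \<Longrightarrow> w \<in> L \<Longrightarrow> d \<le> dist z w"
    using separate_compact_closed[of "sphere 0 R" L] closed_lattice_subset[of L] by auto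
  define \<delta> where "\<delta> = min d (sep / 3)"
  have \<delta>: "0 < \<delta>" "3 * \<delta> \<le> sep" using d sep_pos by (auto simp: \<delta>_def)
  have "compact (\<sigma> ` sphere 0 R)"
    by (intro compact_continuous_image compact_sphere continuous_on_subset[OF holomorphic_on_imp_continuous_on[OF hol]]) auto
  then obtain m where m: "m > 0" "\<And>z. z \<in> sphere 0 R \<Longrightarrow> norm (\<sigma> z) \<le> m"
    using compact_imp_bounded bounded_pos by (metis (no_types, lifting) image_eqI)
  define b where "b = 2 * (M * K / (norm (deriv \<sigma> 0) * \<delta>))"
  have b: "b \<ge> 0" using M0 K0 \<delta> by (simp add: b_def)
  show ?thesis
  proof (rule that)
    fix z
    obtain u where u: "u \<in> L" "norm (z - u) \<le> R0" unfolding R0_def by (rule lattice_near)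
    define Fu where "Fu = (\<lambda>v. F (u + 1 * v))"
    have hol_Fu: "Fu holomorphic_on UNIV"
      using holomorphic_on_compose_gen[OF _ F, of "\<lambda>v. u + 1 * v" UNIV]
      by (simp add: Fu_def o_def holomorphic_intros)
    \<comment> \<open>A translation costs a strict increase of the rate; the midpoint still lies
      below \<open>A\<close>.\<close>
    have "quadratic_growth ((c + A) / 2) Fu"
      unfolding Fu_def using \<open>c < A\<close> by (intro quadratic_growth_affine[OF growth]) auto
    \<comment> \<open>Translation by \<open>u\<close> worsens the lattice bound by this factor. The
      interpolation bound depends affinely on it, which is how \<open>exp (k * norm z)\<close>
      arises in the end.\<close>
    define eu where "eu = exp (k * norm u)"
    have eu: "1 \<le> eu" using k by (simp add: eu_def)
    have Mu: "norm (Fu w) \<le> (M * eu) * exp (k * norm w)" if "w \<in> L" for w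
    proof -
      have "norm (Fu w) \<le> M * exp (k * norm (u + w))"
        unfolding Fu_def using M[OF lattice_add[OF u(1) that]] by simp
      also have "\<dots> \<le> M * exp (k * (norm u + norm w))"
        using M0 k norm_triangle_ineq by (intro mult_left_mono) (auto intro!: mult_left_mono)
      finally show ?thesis by (simp add: eu_def distrib_left exp_add)
    qed
    have "norm (Fu (z - u)) \<le> m * (1 + b) * eu"
    proof (rule maximum_modulus_frontier[where f = Fu and S = "cball 0 R" and \<xi> = "z - u"])
      show "Fu holomorphic_on interior (cball 0 R)" by (rule holomorphic_on_subset[OF hol_Fu]) simp
      show "continuous_on (closure (cball 0 R)) Fu"
        by (rule continuous_on_subset[OF holomorphic_on_imp_continuous_on[OF hol_Fu]]) simp
      show "bounded (cball (0::complex) R)" by simp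
      show "z - u \<in> cball 0 R" using u R by simp
      fix v assume "v \<in> frontier (cball (0::complex) R)"
      then have v: "v \<in> sphere 0 R" by simp
      have "norm (Fu v) \<le> norm (\<sigma> v) * (1 + 2 * ((M * eu) * K / (norm (deriv \<sigma> 0) * \<delta>)))"
      proof (rule interpolation_bound[OF hol_Fu \<open>quadratic_growth ((c + A) / 2) Fu\<close> _ _ Mu \<delta> _ K])
        show "\<delta> \<le> norm (v - w)" if "w \<in> L" for w
          using d(2)[OF v that] by (simp add: \<delta>_def dist_norm)
      qed (use \<open>c < A\<close> M0 eu in auto)
      also have "\<dots> = norm (\<sigma> v) * (1 + b * eu)" by (simp add: b_def)
      also have "\<dots> \<le> m * (eu + b * eu)"
        using m(2)[OF v] m(1) eu b by (intro mult_mono add_mono) auto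
      finally show "norm (Fu v) \<le> m * (1 + b) * eu" by (simp add: algebra_simps)
    qed
    also have "\<dots> \<le> m * (1 + b) * (exp (k * R0) * exp (k * norm z))"
    proof -
      have "norm u \<le> R0 + norm z" using u(2) norm_triangle_ineq2[of u z] by (simp add: norm_minus_commute)
      then have "eu \<le> exp (k * (R0 + norm z))" using k by (simp add: eu_def mult_left_mono)
      then show ?thesis using m b by (intro mult_left_mono) (auto simp: distrib_left exp_add)
    qed
    finally show "norm (F z) \<le> (m * (1 + b) * exp (k * R0)) * exp (k * norm z)"
      by (simp add: Fu_def mult.assoc)
  qed
qed

end

subsection \<open>Phase retrieval\<close>

lemma holomorphic_reflection:
  assumes "h holomorphic_on UNIV"
  shows "(\<lambda>z. cnj (h (cnj z))) holomorphic_on UNIV"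
  using holomorphic_on_compose_cnj_cnj[OF holomorphic_on_subset[OF assms subset_UNIV] open_UNIV]
  by (simp add: o_def)

text \<open>The three numerical conditions serve three steps:
  \<open>c < pi / (2 * Im \<tau>)\<close> the interpolation, \<open>2 * k < pi\<close> Carlson's
  theorem along the rows, and \<open>2 * k * Im \<tau> < pi\<close> Carlson's theorem across the
  rows.\<close>

lemma phase_determined_on_normalized_lattice:
  fixes F G :: "complex \<Rightarrow> complex" and \<tau> :: complex
  assumes \<tau>: "Im \<tau> > 0"
    and F: "F holomorphic_on UNIV" and G: "G holomorphic_on UNIV"
    and growth: "quadratic_growth c F" and c: "c < pi / (2 * Im \<tau>)"
    and type: "\<And>z. norm (G z) \<le> C * exp (k * norm z)"
    and k: "0 \<le> k" "2 * k < pi" "2 * k * Im \<tau> < pi"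
    and eq: "\<And>w. w \<in> shifted_lattice 0 \<tau> 1 \<Longrightarrow> norm (F w) = norm (G w)"
  obtains u where "norm u = 1" "\<And>z. F z = u * G z"
proof -
  obtain \<sigma> where \<sigma>: "\<sigma> holomorphic_on UNIV"
    "\<And>z w. w \<in> shifted_lattice 0 \<tau> 1 \<Longrightarrow>
      norm (\<sigma> (z + w)) * exp (- (pi / (2 * Im \<tau>)) * (norm (z + w))\<^sup>2) =
      norm (\<sigma> z) * exp (- (pi / (2 * Im \<tau>)) * (norm z)\<^sup>2)"
    "\<And>z. \<sigma> z = 0 \<longleftrightarrow> z \<in> shifted_lattice 0 \<tau> 1"
    "deriv \<sigma> 0 \<noteq> 0"
    using sigma_function_exists[OF \<tau>] by blast
  interpret S: sigma_function \<tau> \<sigma> "pi / (2 * Im \<tau>)"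
    using \<tau> \<sigma> by unfold_locales auto
  have "norm (F w) \<le> C * exp (k * norm w)" if "w \<in> shifted_lattice 0 \<tau> 1" for w
    using eq[OF that] type by simp
  then obtain C' where C': "\<And>z. norm (F z) \<le> C' * exp (k * norm z)"
    using S.exponential_type_of_lattice_bound[OF F growth c k(1)] by blast
  have C: "0 \<le> C" "0 \<le> C'"
    using type[of 0] C'[of 0] order_trans[OF norm_ge_zero] by auto
  have shift: "(\<lambda>z. h (a + z)) holomorphic_on UNIV" if "h holomorphic_on UNIV" for h :: "complex \<Rightarrow> complex" and a
    using holomorphic_on_compose_gen[OF _ that, of "\<lambda>z. a + z" UNIV] by (simp add: o_def holomorphic_intros)
  \<comment> \<open>An entire function of \<open>z\<close> that equals the squared modulus of
    \<open>h (a + z)\<close> for real \<open>z\<close>; the price is a doubled type.\<close>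
  have refl: "(\<lambda>z. h (a + z) * cnj (h (a + cnj z))) holomorphic_on UNIV"
    if "h holomorphic_on UNIV" for h :: "complex \<Rightarrow> complex" and a
    using holomorphic_reflection[OF shift[OF that]] shift[OF that] by (intro holomorphic_intros)
  have refl_bound: "norm (h (a + z) * cnj (h (a + cnj z))) \<le> (D * exp (k * norm a))\<^sup>2 * exp (2 * k * norm z)"
    if D: "0 \<le> D" "\<And>z. norm (h z) \<le> D * exp (k * norm z)" for h :: "complex \<Rightarrow> complex" and D a z
  proof -
    have b: "norm (h (a + v)) \<le> D * exp (k * norm a) * exp (k * norm z)" if "norm v = norm z" for v
    proof -
      have "norm (h (a + v)) \<le> D * exp (k * norm (a + v))" by (rule D)
      also have "\<dots> \<le> D * exp (k * (norm a + norm z))"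
        using D k norm_triangle_ineq[of a v] that by (intro mult_left_mono) (auto intro!: mult_left_mono)
      finally show ?thesis by (simp add: distrib_left exp_add mult.assoc)
    qed
    have "norm (h (a + z) * cnj (h (a + cnj z))) \<le>
        (D * exp (k * norm a) * exp (k * norm z)) * (D * exp (k * norm a) * exp (k * norm z))"
      unfolding norm_mult complex_mod_cnj using D by (intro mult_mono b) auto
    also have "\<dots> = (D * exp (k * norm a))\<^sup>2 * exp (k * norm z + k * norm z)"
      unfolding exp_add by (simp add: power2_eq_square mult_ac)
    finally show ?thesis by (simp add: mult.assoc)
  qed
  have line: "F (a + z) * cnj (F (a + cnj z)) = G (a + z) * cnj (G (a + cnj z))"
    if a: "a = \<tau> * of_int m" for a m z
  proof -
    define h where "h = (\<lambda>z. F (a + z) * cnj (F (a + cnj z)) - G (a + z) * cnj (G (a + cnj z)))"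
    have "h z = 0"
    proof (rule carlson[where h = h])
      show "h holomorphic_on UNIV"
        unfolding h_def by (intro holomorphic_on_diff refl F G)
      show "norm (h z) \<le> ((C' * exp (k * norm a))\<^sup>2 + (C * exp (k * norm a))\<^sup>2) * exp (2 * k * norm z)" for z
        unfolding h_def distrib_right
        by (rule order_trans[OF norm_triangle_ineq4 add_mono]) (intro refl_bound C C' type)+
      show "h (0 + 1 * of_int n) = 0" for n
      proof -
        have "norm (F (a + of_int n)) = norm (G (a + of_int n))"
          unfolding a by (intro eq S.latticeI)
        then show ?thesis by (simp add: h_def complex_norm_square[symmetric])
      qed
    qed (use k in auto)
    then show ?thesis by (simp add: h_def)
  qed
  have key: "F w * cnj (F v) = G w * cnj (G v)" for w v
  proof -
    \<comment> \<open>Conjugating the argument makes the dependence on the second point holomorphic.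
      With \<open>w\<close> fixed only one factor varies, so the type is \<open>k\<close> and not
      \<open>2 * k\<close>.\<close>
    define h where "h = (\<lambda>\<zeta>. F w * cnj (F (cnj \<zeta>)) - G w * cnj (G (cnj \<zeta>)))"
    have "h (cnj v) = 0"
    proof (rule carlson[where h = h])
      show "h holomorphic_on UNIV"
        unfolding h_def by (intro holomorphic_intros holomorphic_reflection F G)
      show "norm (h \<zeta>) \<le> (norm (F w) * C' + norm (G w) * C) * exp (k * norm \<zeta>)" for \<zeta>
      proof -
        have "norm (h \<zeta>) \<le> norm (F w) * norm (F (cnj \<zeta>)) + norm (G w) * norm (G (cnj \<zeta>))"
          unfolding h_def by (rule order_trans[OF norm_triangle_ineq4]) (simp add: norm_mult)
        also have "\<dots> \<le> norm (F w) * (C' * exp (k * norm \<zeta>)) + norm (G w) * (C * exp (k * norm \<zeta>))"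
          using C'[of "cnj \<zeta>"] type[of "cnj \<zeta>"] by (intro add_mono mult_left_mono) auto
        finally show ?thesis by (simp add: algebra_simps)
      qed
      \<comment> \<open>The identity \<open>line\<close> for the row through \<open>a\<close> pairs
        \<open>w\<close> with its mirror image in that row. The conjugates of these images over all
        rows form the progression of step \<open>- 2 * \<i> * Im \<tau>\<close> through
        \<open>w\<close>.\<close>
      show "h (w + - (2 * \<i> * of_real (Im \<tau>)) * of_int m) = 0" for m
      proof -
        define a where "a = \<tau> * of_int m"
        define b where "b = w + - (2 * \<i> * of_real (Im \<tau>)) * of_int m"
        have ab: "a + cnj (w - a) = cnj b"
          by (simp add: a_def b_def complex_eq_iff)
        have "F w * cnj (F (cnj b)) = G w * cnj (G (cnj b))"
          using line[OF a_def, of "w - a"] unfolding ab by simp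
        then show ?thesis unfolding b_def[symmetric] by (simp add: h_def)
      qed
      show "k * norm (- (2 * \<i> * complex_of_real (Im \<tau>))) < pi"
        using k \<tau> by (simp add: norm_mult mult_ac)
    qed (use k \<tau> in auto)
    then show ?thesis by (simp add: h_def)
  qed
  show ?thesis
  proof (cases "\<forall>v. G v = 0")
    case True
    then have "F z = 0" for z using key[of z z] by simp
    then show ?thesis using that[of 1] True by simp
  next
    case False
    then obtain v where v: "G v \<noteq> 0" by blast
    have "of_real ((norm (F v))\<^sup>2) = (of_real ((norm (G v))\<^sup>2) :: complex)"
      using key[of v v] by (simp only: complex_norm_square)
    then have nv: "norm (F v) = norm (G v)" by (simp only: of_real_eq_iff) simp
    then have Fv: "F v \<noteq> 0" using v by auto
    show ?thesis
    proof (rule that)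
      show "norm (cnj (G v) / cnj (F v)) = 1" using nv v by (simp add: norm_divide)
      show "F z = cnj (G v) / cnj (F v) * G z" for z
        using key[of z v] Fv by (simp add: field_simps)
    qed
  qed
qed

section \<open>Growth orders turned into explicit bounds\<close>

lemma norm_le_max_modulus:
  assumes "continuous_on UNIV f" "norm z = r"
  shows "norm (f z) \<le> max_modulus f r"
proof -
  have "compact ((\<lambda>z. norm (f z)) ` sphere 0 r)"
    by (intro compact_continuous_image continuous_intros continuous_on_subset[OF assms(1)]) auto
  then have "bdd_above ((\<lambda>z. norm (f z)) ` sphere 0 r)"
    by (intro bounded_imp_bdd_above compact_imp_bounded)
  then show ?thesis
    unfolding max_modulus_def using assms(2) by (intro cSUP_upper) auto
qed

lemma max_modulus_le_exp:
  assumes f: "continuous_on UNIV f" and "r \<ge> 0" "s > 0" and lt: "elog (max_modulus f r) / ereal s < ereal c"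
  shows "max_modulus f r \<le> exp (c * s)"
\<comment> \<open>A vanishing maximum has \<open>elog\<close> equal to \<open>-\<infinity>\<close>
  and is treated apart; the claim is then trivial.\<close>
proof (cases "max_modulus f r = 0")
  case False
  have "0 \<le> norm (f (of_real r))" by simp
  also have "\<dots> \<le> max_modulus f r" using f assms(2) by (intro norm_le_max_modulus) auto
  finally have pos: "max_modulus f r > 0" using False by simp
  have "ln (max_modulus f r) / s < c"
    using lt False \<open>s > 0\<close> by (simp add: elog_def)
  then have "ln (max_modulus f r) \<le> c * s" using \<open>s > 0\<close> by (simp add: field_simps)
  then show ?thesis using pos by (metis exp_le_cancel_iff exp_ln)
qed simp

text \<open>The upper limit gives the bound outside a disc, compactness gives a constant inside
  it.\<close>

lemma exponential_type_imp_bound: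
  assumes g: "exponential_type g \<kappa>" and "\<kappa> < k"
  obtains C where "\<And>z. norm (g z) \<le> C * exp (k * norm z)"
proof -
  have cont: "continuous_on UNIV g"
    using g by (auto simp: exponential_type_def intro: holomorphic_on_imp_continuous_on)
  have "Limsup at_top (\<lambda>r::real. elog (max_modulus g r) / ereal r) < ereal k"
    using assms by (simp add: exponential_type_def)
  then have "eventually (\<lambda>r. elog (max_modulus g r) / ereal r < ereal k) at_top"
    by (rule Limsup_lessD)
  then obtain R0 where R0: "\<And>r. r \<ge> R0 \<Longrightarrow> elog (max_modulus g r) / ereal r < ereal k"
    unfolding eventually_at_top_linorder by auto
  define R where "R = max R0 1"
  have big: "norm (g z) \<le> exp (k * norm z)" if "norm z \<ge> R" for z
  proof -
    have "norm z \<ge> R0" "norm z \<ge> 0" "norm z > 0" using that unfolding R_def by linarith+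
    then have "max_modulus g (norm z) \<le> exp (k * norm z)"
      by (intro max_modulus_le_exp[OF cont] R0)
    then show ?thesis using norm_le_max_modulus[OF cont refl, of z] by linarith
  qed
  have "compact ((\<lambda>z. norm (g z) * exp (- (k * norm z))) ` cball 0 R)"
    by (intro compact_continuous_image continuous_intros continuous_on_subset[OF cont]) auto
  then have "bounded ((\<lambda>z. norm (g z) * exp (- (k * norm z))) ` cball 0 R)"
    by (rule compact_imp_bounded)
  then obtain B where B: "\<And>z. norm z \<le> R \<Longrightarrow> norm (g z) * exp (- (k * norm z)) \<le> B"
    by (force simp: bounded_iff)
  show ?thesis
  proof (rule that)
    fix z
    show "norm (g z) \<le> max B 1 * exp (k * norm z)"
    proof (cases "norm z \<le> R")
      case True
      then have "norm (g z) \<le> B * exp (k * norm z)"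
        using B[OF True] by (simp add: exp_minus field_simps)
      also have "\<dots> \<le> max B 1 * exp (k * norm z)" by (intro mult_right_mono) auto
      finally show ?thesis .
    next
      case False
      then have "norm (g z) \<le> 1 * exp (k * norm z)" using big by simp
      also have "\<dots> \<le> max B 1 * exp (k * norm z)" by (intro mult_right_mono) auto
      finally show ?thesis .
    qed
  qed
qed

text \<open>A lower limit below \<open>c\<close> supplies arbitrarily large good circles, and the
  maximum principle fills in the discs.\<close>

lemma quadratic_growth_of_lower_growth:
  assumes f: "f holomorphic_on UNIV" and lt: "lower_quadratic_growth f < ereal c"
  shows "quadratic_growth c f"
  unfolding quadratic_growth_def
proof
  fix R
  have cont: "continuous_on UNIV f" using f by (rule holomorphic_on_imp_continuous_on)
  \<comment> \<open>The \<open>1\<close> keeps \<open>r\<close> positive, so that dividing by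
    \<open>r\<^sup>2\<close> is meaningful.\<close>
  have "\<exists>r\<ge>max R 1. elog (max_modulus f r) / ereal (r\<^sup>2) < ereal c"
  proof (rule ccontr)
    assume "\<not> ?thesis"
    then have "eventually (\<lambda>r. ereal c \<le> elog (max_modulus f r) / ereal (r\<^sup>2)) at_top"
      unfolding eventually_at_top_linorder by (metis not_less)
    then have "ereal c \<le> lower_quadratic_growth f"
      unfolding lower_quadratic_growth_def by (rule Liminf_bounded)
    then show False using lt by simp
  qed
  then obtain r where r: "r \<ge> max R 1" "elog (max_modulus f r) / ereal (r\<^sup>2) < ereal c" by blast
  show "\<exists>r\<ge>R. \<forall>z. norm z \<le> r \<longrightarrow> norm (f z) \<le> exp (c * r\<^sup>2)"
  proof (intro exI[of _ r] conjI allI impI)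
    show "R \<le> r" using r by simp
    fix z :: complex assume z: "norm z \<le> r"
    show "norm (f z) \<le> exp (c * r\<^sup>2)"
    proof (rule maximum_modulus_frontier[where f = f and S = "cball 0 r" and \<xi> = z])
      show "f holomorphic_on interior (cball 0 r)" by (rule holomorphic_on_subset[OF f]) simp
      show "continuous_on (closure (cball 0 r)) f" by (rule continuous_on_subset[OF cont]) simp
      fix w assume "w \<in> frontier (cball (0::complex) r)"
      then have "norm (f w) \<le> max_modulus f r" by (intro norm_le_max_modulus cont) simp
      also have "\<dots> \<le> exp (c * r\<^sup>2)"
        using r by (intro max_modulus_le_exp cont) auto
      finally show "norm (f w) \<le> exp (c * r\<^sup>2)" .
    qed (use z in auto)
  qed
qed

theorem corollary2:
  fixes f g :: "complex \<Rightarrow> complex"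
    and \<kappa> :: real
    and \<tau> :: ereal
    and z0 \<omega>1 \<omega>2 :: complex
    and \<Lambda> :: "complex set"
  defines "\<tau> \<equiv> lower_quadratic_growth f"
    and "\<Lambda> \<equiv> shifted_lattice z0 \<omega>1 \<omega>2"
  assumes "f holomorphic_on UNIV"
    and "g holomorphic_on UNIV"
    and "\<tau> < \<infinity>"
    and "0 \<le> \<kappa>"
    and "exponential_type g \<kappa>"
    and "\<omega>1 \<noteq> 0" and "\<omega>2 \<noteq> 0"
    and "\<omega>1 / \<omega>2 \<notin> \<real>"
    and "0 < \<tau> \<longrightarrow> ereal (covol \<omega>1 \<omega>2) < ereal pi / (2 * \<tau>)"
    and "2 * \<kappa> * norm \<omega>2 < pi"
    and "2 * \<kappa> * (\<bar>Im (\<omega>1 * cnj \<omega>2)\<bar> / norm \<omega>2) < pi"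
  shows "f \<sim>\<^sub>p g \<longleftrightarrow> (\<forall>z\<in>\<Lambda>. norm (f z) = norm (g z))"
proof
  assume "f \<sim>\<^sub>p g"
  then show "\<forall>z\<in>\<Lambda>. norm (f z) = norm (g z)"
    by (auto simp: equal_up_to_phase_def norm_mult)
next
  assume eq: "\<forall>z\<in>\<Lambda>. norm (f z) = norm (g z)"
  note f = \<open>f holomorphic_on UNIV\<close> and g = \<open>g holomorphic_on UNIV\<close> and w2 = \<open>\<omega>2 \<noteq> 0\<close>
  have Im_quot: "Im (\<omega>1 / \<omega>2) = Im (\<omega>1 * cnj \<omega>2) / (norm \<omega>2)\<^sup>2"
    by (subst complex_div_cnj) (simp flip: of_real_power)
  have Im_nz: "Im (\<omega>1 / \<omega>2) \<noteq> 0"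
    using \<open>\<omega>1 / \<omega>2 \<notin> \<real>\<close> by (simp add: complex_is_Real_iff)
  \<comment> \<open>Changing the sign of \<open>\<omega>1\<close> leaves the lattice unchanged and
    puts the quotient in the upper half-plane.\<close>
  define s :: int where "s = (if Im (\<omega>1 / \<omega>2) > 0 then 1 else - 1)"
  define \<tau>' where "\<tau>' = of_int s * (\<omega>1 / \<omega>2)"
  have Im_\<tau>': "Im \<tau>' = \<bar>Im (\<omega>1 / \<omega>2)\<bar>"
    by (auto simp: \<tau>'_def s_def)
  then have t: "Im \<tau>' > 0" using Im_nz by simp
  have covol: "covol \<omega>1 \<omega>2 = Im \<tau>' * (norm \<omega>2)\<^sup>2"
    using w2 by (simp add: Im_\<tau>' Im_quot covol_def)
  have covol_pos: "covol \<omega>1 \<omega>2 > 0" using t w2 by (simp add: covol)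
  \<comment> \<open>A real rate strictly between the growth of \<open>f\<close> and the critical
    one. For \<open>\<tau> \<le> 0\<close>, including \<open>-\<infinity>\<close>, half the critical
    rate works without the covolume condition.\<close>
  obtain c where c: "\<tau> < ereal c" "c < pi / (2 * covol \<omega>1 \<omega>2)"
  proof (cases "0 < \<tau>")
    case False
    then have "\<tau> < ereal (pi / (4 * covol \<omega>1 \<omega>2))"
      using covol_pos by (simp add: not_less le_less_trans)
    then show ?thesis using that[of "pi / (4 * covol \<omega>1 \<omega>2)"] covol_pos by (simp add: field_simps)
  next
    case True
    then obtain x where x: "\<tau> = ereal x" "x > 0"
      using \<open>\<tau> < \<infinity>\<close> by (cases \<tau>) auto
    have "covol \<omega>1 \<omega>2 < pi / (2 * x)"
      using assms(11) True x by simp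
    then have "x < pi / (2 * covol \<omega>1 \<omega>2)" using x covol_pos by (simp add: field_simps)
    then show ?thesis using dense[of x "pi / (2 * covol \<omega>1 \<omega>2)"] that x by auto
  qed
  have "c * (norm \<omega>2)\<^sup>2 < pi / (2 * Im \<tau>')"
    using c(2) t w2 unfolding covol by (simp add: field_simps)
  \<comment> \<open>Scaling by \<open>\<omega>2\<close> multiplies the rate by
    \<open>(norm \<omega>2)\<^sup>2\<close>; the shift by \<open>z0\<close> uses up one more strict
    inequality.\<close>
  then obtain c' where c': "c * (norm \<omega>2)\<^sup>2 < c'" "c' < pi / (2 * Im \<tau>')"
    using dense by blast
  have k1: "\<kappa> < pi / (2 * norm \<omega>2)" "\<kappa> < pi / (2 * (norm \<omega>2 * Im \<tau>'))"
  proof -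
    show "\<kappa> < pi / (2 * norm \<omega>2)"
      using \<open>2 * \<kappa> * norm \<omega>2 < pi\<close> w2 by (simp add: field_simps)
    have "\<bar>Im (\<omega>1 * cnj \<omega>2)\<bar> / norm \<omega>2 = norm \<omega>2 * Im \<tau>'"
      using covol w2 by (simp add: covol_def power2_eq_square)
    then show "\<kappa> < pi / (2 * (norm \<omega>2 * Im \<tau>'))"
      using assms(13) t w2 by (simp add: field_simps)
  qed
  \<comment> \<open>The type gives an explicit bound only for exponents above
    \<open>\<kappa>\<close>; the strict hypotheses leave room for one.\<close>
  then obtain k where k: "\<kappa> < k" "k < pi / (2 * norm \<omega>2)" "k < pi / (2 * (norm \<omega>2 * Im \<tau>'))"
    using dense[of \<kappa> "min (pi / (2 * norm \<omega>2)) (pi / (2 * (norm \<omega>2 * Im \<tau>')))"] by auto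
  have k0: "k > 0" using k(1) \<open>0 \<le> \<kappa>\<close> by simp
  obtain C where C: "\<And>z. norm (g z) \<le> C * exp (k * norm z)"
    using exponential_type_imp_bound[OF \<open>exponential_type g \<kappa>\<close> k(1)] by blast
  have C0: "C \<ge> 0" using C[of 0] order_trans[OF norm_ge_zero] by auto
  define F where "F = (\<lambda>z. f (z0 + \<omega>2 * z))"
  define G where "G = (\<lambda>z. g (z0 + \<omega>2 * z))"
  obtain u where u: "norm u = 1" "\<And>z. F z = u * G z"
  proof (rule phase_determined_on_normalized_lattice[OF t, of F G c' "C * exp (k * norm z0)" "k * norm \<omega>2"])
    show "F holomorphic_on UNIV" "G holomorphic_on UNIV"
      using holomorphic_on_compose_gen[OF _ f, of "\<lambda>z. z0 + \<omega>2 * z" UNIV]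
        holomorphic_on_compose_gen[OF _ g, of "\<lambda>z. z0 + \<omega>2 * z" UNIV]
      by (simp_all add: F_def G_def o_def holomorphic_intros)
    show "quadratic_growth c' F"
      unfolding F_def using c(1) f
      by (intro quadratic_growth_affine[OF quadratic_growth_of_lower_growth w2 c'(1)]) (auto simp: \<tau>_def)
    show "norm (G z) \<le> C * exp (k * norm z0) * exp (k * norm \<omega>2 * norm z)" for z
    proof -
      have "norm (G z) \<le> C * exp (k * norm (z0 + \<omega>2 * z))" unfolding G_def by (rule C)
      also have "\<dots> \<le> C * exp (k * (norm z0 + norm \<omega>2 * norm z))"
        using C0 k0 norm_triangle_ineq[of z0 "\<omega>2 * z"]
        by (intro mult_left_mono) (auto simp: norm_mult intro!: mult_left_mono)
      finally show ?thesis by (simp add: distrib_left exp_add mult_ac)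
    qed
    show "norm (F w) = norm (G w)" if wL: "w \<in> shifted_lattice 0 \<tau>' 1" for w
    proof -
      obtain m n where w: "w = \<tau>' * of_int m + of_int n"
        using wL by (auto simp: shifted_lattice_def)
      \<comment> \<open>The sign \<open>s\<close> is absorbed into the coefficient of
        \<open>\<omega>1\<close>, so normalized lattice points correspond to points of
        \<open>\<Lambda>\<close>.\<close>
      have "z0 + \<omega>2 * w = z0 + \<omega>1 * of_int (s * m) + \<omega>2 * of_int n"
        using w2 by (simp add: w \<tau>'_def algebra_simps)
      then have "z0 + \<omega>2 * w \<in> \<Lambda>"
        unfolding \<Lambda>_def shifted_lattice_def by blast
      then show ?thesis using eq by (simp add: F_def G_def)
    qed
    show "c' < pi / (2 * Im \<tau>')" by (rule c'(2))
    show "0 \<le> k * norm \<omega>2" using k0 by simp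
    show "2 * (k * norm \<omega>2) < pi" "2 * (k * norm \<omega>2) * Im \<tau>' < pi"
      using k w2 t by (simp_all add: field_simps)
  qed auto
  have "f z = u * g z" for z
    using u(2)[of "(z - z0) / \<omega>2"] w2 by (simp add: F_def G_def)
  then show "f \<sim>\<^sub>p g"
    using u(1) by (auto simp: equal_up_to_phase_def)
qed

end
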